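(* Let $G$ be a unicyclic graph of order $n\geq 6$ such that $G\ncong H(n,4;n-4,0,0,0)$ and $G$ is not isomorphic to any $H(n,3;n_1,n_2,n_3)$. Then $ABC_3(G)\leq (n-1)\sqrt{\tfrac12}+f(3,3)$, with equality if and only if $G$ is isomorphic to one of: $H(n,5;n-5,0,0,0,0)$; $H(n,4;n_1,n-n_1-4,0,0)$ for some integer $n_1$ with $n_1\geq 1$ and $n-n_1-4\geq1$; or $H^t(n,3;n-t-3,0,0)$ for some integer $t$ with $t\geq 1$ and $n-t-3\geq 1$.
   Context: All graphs are simple and connected. For a vertex $u$ of a graph $G$, the eccentricity $e_G(u)$ is $\max\{d_G(u,v): v\in V(G)\}$, where $d_G$ is the shortest-path distance. For real $x,y\geq 1$, $f(x,y)=\sqrt{\frac{x+y-2}{xy}}$, and $ABC_3(G)=\sum_{uv\in E(G)} f(e_G(u),e_G(v))$. A unicyclic graph is a connected graph with exactly one cycle. For nonnegative integers $n_1,\ldots,n_k$ with $\sum_i n_i=n-k$, $H(n,k;n_1,\ldots,n_k)$ is the graph of order $n$ obtained from the cycle $C_k=v_1v_2\cdots v_kv_1$ by attaching $n_i$ new pendent vertices to $v_i$ for each $i$. For integers $m,t\geq 1$ with $n=3+m+t$, $H^t(n,3;m,0,0)$ is the graph of order $n$ obtained from the triangle $v_1v_2v_3v_1$ by attaching $m$ new pendent vertices to $v_1$ and then attaching $t$ further new pendent vertices to one of those $m$ pendent vertices. *)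

theory Defs
  imports Complex_Main "Graph_Theory.Graph_Theory"
begin

text \<open>
  A simple graph is a \<^locale>\<open>pair_graph\<close>: finite, loop-free, without parallel arcs and symmetric,
  so that each undirected edge \<open>uv\<close> is represented by the two arcs \<open>(u, v)\<close> and \<open>(v, u)\<close>.
\<close>

text \<open>
  A cycle is identified with its set of undirected edges, since the closed walks of
  \<^const>\<open>pre_digraph.cycle\<close> carry a starting point and a direction. The bound on the length
  excludes the closed walks that go back and forth along a single edge.
\<close>

definition cycles :: "'a pair_pre_digraph \<Rightarrow> 'a set set set" where
  "cycles G =
    {(\<lambda>(u, v). {u, v}) ` set p | p. pre_digraph.cycle (with_proj G) p \<and> length p \<ge> 3}"

definition unicyclic :: "'a pair_pre_digraph \<Rightarrow> bool" where
  "unicyclic G \<longleftrightarrow>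
    pair_graph G \<and> Digraph_Component.connected (with_proj G) \<and> (\<exists>!C. C \<in> cycles G)"

definition gdist :: "'a pair_pre_digraph \<Rightarrow> 'a \<Rightarrow> 'a \<Rightarrow> real" where
  "gdist G u v = real_of_ereal (wf_digraph.\<mu> (with_proj G) (\<lambda>_. 1) u v)"

definition ecc :: "'a pair_pre_digraph \<Rightarrow> 'a \<Rightarrow> real" where
  "ecc G u = Max {gdist G u v | v. v \<in> pverts G}"

definition abc_f :: "real \<Rightarrow> real \<Rightarrow> real" where
  "abc_f x y = sqrt ((x + y - 2) / (x * y))"

text \<open>The factor 2 accounts for the two arcs of each edge; note that \<open>abc_f\<close> is symmetric.\<close>

definition ABC3 :: "'a pair_pre_digraph \<Rightarrow> real" where
  "ABC3 G = (\<Sum>(u, v)\<in>parcs G. abc_f (ecc G u) (ecc G v)) / 2"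

definition graph_iso :: "'a pair_pre_digraph \<Rightarrow> 'b pair_pre_digraph \<Rightarrow> bool" where
  "graph_iso G H \<longleftrightarrow> digraph_iso (with_proj G) (with_proj H)"

text \<open>
  \<open>cycle_pendants [n\<^sub>1, \<dots>, n\<^sub>k]\<close> is \<open>H(n, k; n\<^sub>1, \<dots>, n\<^sub>k)\<close> with \<open>n = k + n\<^sub>1 + \<dots> + n\<^sub>k\<close>, for
  \<open>k \<ge> 3\<close>. The cycle vertex \<open>v\<^sub>i\<close> is \<open>(i - 1, 0)\<close> and its pendent vertices are
  \<open>(i - 1, j)\<close> for \<open>1 \<le> j \<le> n\<^sub>i\<close>.
\<close>

definition cycle_pendants :: "nat list \<Rightarrow> (nat \<times> nat) pair_pre_digraph" where
  "cycle_pendants ns = \<lparr>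
     pverts = {(i, j). i < length ns \<and> j \<le> ns ! i},
     parcs = symcl ({((i, 0), (Suc i mod length ns, 0)) | i. i < length ns} \<union>
                    {((i, 0), (i, j)) | i j. i < length ns \<and> 1 \<le> j \<and> j \<le> ns ! i}) \<rparr>"

text \<open>
  \<open>triangle_pendants_ext t m\<close> is \<open>H\<^sup>t(n, 3; m, 0, 0)\<close> with \<open>n = 3 + m + t\<close>, for \<open>m \<ge> 1\<close>. The
  \<open>t\<close> further vertices are \<open>(3, j)\<close> for \<open>1 \<le> j \<le> t\<close>, attached to the pendent vertex \<open>(0, 1)\<close>.
\<close>

definition triangle_pendants_ext :: "nat \<Rightarrow> nat \<Rightarrow> (nat \<times> nat) pair_pre_digraph" where
  "triangle_pendants_ext t m = (let T = cycle_pendants [m, 0, 0] in \<lparr>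
     pverts = pverts T \<union> {(3, j) | j. 1 \<le> j \<and> j \<le> t},
     parcs = parcs T \<union> symcl {((0, 1), (3, j)) | j. 1 \<le> j \<and> j \<le> t} \<rparr>)"

end

theory Submission
  imports Defs
begin

text \<open>
  Call a vertex central if its eccentricity is at most 2, and universal if it is at most 1. If no
  vertex is universal, every edge contributes at most \<open>\<surd>(1/2)\<close>, with equality when one end is
  central, while an edge with two non-central ends contributes at most \<open>f(3,3) < \<surd>(1/2)\<close>.
  Every edge outside a breadth-first spanning tree closes its own cycle, so there are at most \<open>n\<close>
  edges, and a graph with two non-central edges or with at most \<open>n - 1\<close> edges stays strictly below
  the bound. For a central root \<open>c\<close> the tree has depth 2, with levels \<open>A\<close> and \<open>B\<close>, and at most one
  edge \<open>xy\<close> is missing from it; distinguishing whether \<open>xy\<close> joins \<open>A\<close> to \<open>A\<close>, \<open>B\<close> to \<open>A\<close> or \<open>B\<close> to \<open>B\<close>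
  leaves either two non-central edges or one of the named graphs.
\<close>

section \<open>Isomorphism with the named graphs\<close>

text \<open>The bound is the value of \<open>n\<close> edges of which exactly one has two
  non-central ends, both of eccentricity 3. The families excluded by hypothesis are graphs in which
  every edge has a central end; they reach \<open>n * sqrt (1 / 2)\<close>, above the bound, so no
  estimate can remove them and the case analysis has to keep them as outcomes beside the extremal
  graphs. Each edge with two non-central ends costs at least \<open>sqrt (1 / 2) - 2 / 3\<close>,
  which is positive because 4/9 < 1/2; a second such edge therefore pushes the sum strictly below
  the bound. An end of eccentricity 1 falls outside the estimate for edges, so a universal root is
  treated apart; there the tree is a star. Two notions are awkward to compute with: eccentricities
  are maxima of infima over walks, and isomorphisms relate unrelated vertex types. The former are
  replaced by quantified adjacency statements, the latter by a partition of the vertex set of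
  \<open>G\<close> with one orientation of each edge. Every case then becomes first-order reasoning
  about adjacency.\<close>

lemma graph_iso_iff:
  assumes "pair_wf_digraph G" "pair_wf_digraph H"
  shows "graph_iso G H \<longleftrightarrow>
    (\<exists>g. bij_betw g (pverts H) (pverts G) \<and> parcs G = map_prod g g ` parcs H)"
proof
  interpret G: pair_wf_digraph G by fact
  assume "graph_iso G H"
  then obtain f where f: "pre_digraph.digraph_isomorphism (with_proj G) f"
    and H: "with_proj H = app_iso f (with_proj G)"
    unfolding graph_iso_def digraph_iso_def by blast
  define h where "h = iso_verts f"
  have V: "pverts H = h ` pverts G" and A: "parcs H = iso_arcs f ` parcs G"
    and t: "iso_tail f = fst" "iso_head f = snd"
    using arg_cong[OF H, of verts] arg_cong[OF H, of arcs] arg_cong[OF H, of tail]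
      arg_cong[OF H, of head] by (auto simp: h_def)
  have inj: "inj_on h (pverts G)"
    and "\<forall>a\<in>parcs G. h (fst a) = fst (iso_arcs f a) \<and> h (snd a) = snd (iso_arcs f a)"
    using f unfolding pre_digraph.digraph_isomorphism_def by (auto simp: t h_def)
  \<comment> \<open>Tails and heads are \<open>fst\<close> and \<open>snd\<close> on both sides, so
    the vertex map determines the arc map componentwise.\<close>
  then have "iso_arcs f a = map_prod h h a" if "a \<in> parcs G" for a
    using that by (auto simp: prod_eq_iff)
  then have A': "parcs H = map_prod h h ` parcs G"
    unfolding A by (intro image_cong) auto
  \<comment> \<open>The isomorphism maps \<open>G\<close> onto \<open>H\<close>; its inverse is
    kept, so that vertices and arcs of \<open>G\<close> become images of explicitly given
    sets.\<close>
  let ?g = "the_inv_into (pverts G) h"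
  have "bij_betw ?g (pverts H) (pverts G)"
    unfolding V using inj by (intro bij_betw_the_inv_into) (simp add: bij_betw_def)
  moreover have "map_prod ?g ?g (map_prod h h a) = a" if "a \<in> parcs G" for a
    using that inj by (cases a) (auto simp: the_inv_into_f_f G.wellformed')
  then have "parcs G = map_prod ?g ?g ` parcs H"
    unfolding A' by (force simp: image_image)
  ultimately show "\<exists>g. bij_betw g (pverts H) (pverts G) \<and> parcs G = map_prod g g ` parcs H"
    by blast
next
  interpret G: pair_wf_digraph G by fact
  interpret H: pair_wf_digraph H by fact
  assume "\<exists>g. bij_betw g (pverts H) (pverts G) \<and> parcs G = map_prod g g ` parcs H"
  then obtain g where g: "bij_betw g (pverts H) (pverts G)" and A: "parcs G = map_prod g g ` parcs H"
    by blast
  let ?h = "the_inv_into (pverts H) g"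
  let ?f = "\<lparr>iso_verts = ?h, iso_arcs = map_prod ?h ?h, iso_head = snd, iso_tail = fst\<rparr>"
  have h: "bij_betw ?h (pverts G) (pverts H)"
    using g by (rule bij_betw_the_inv_into)
  have "inj_on (map_prod ?h ?h) (pverts G \<times> pverts G)"
    using h by (intro map_prod_inj_on) (auto simp: bij_betw_def)
  then have "inj_on (map_prod ?h ?h) (parcs G)"
    by (rule inj_on_subset) (auto simp: G.wellformed')
  moreover have "map_prod ?h ?h (map_prod g g a) = a" if "a \<in> parcs H" for a
    using that g by (cases a) (auto simp: the_inv_into_f_f H.wellformed' bij_betw_def)
  then have "parcs H = map_prod ?h ?h ` parcs G"
    unfolding A by (force simp: image_image)
  ultimately have "pre_digraph.digraph_isomorphism (with_proj G) ?f"
    "with_proj H = app_iso ?f (with_proj G)"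
    using h G.wf_digraph_axioms
    by (auto simp: pre_digraph.digraph_isomorphism_def bij_betw_def app_iso_def with_proj_def)
  then show "graph_iso G H"
    unfolding graph_iso_def digraph_iso_def by blast
qed

lemma symcl_iff: "(u, v) \<in> symcl R \<longleftrightarrow> (u, v) \<in> R \<or> (v, u) \<in> R"
  by (auto simp: symcl_def)

lemma symcl_Un: "symcl (R \<union> S) = symcl R \<union> symcl S"
  by (auto simp: symcl_def)

text \<open>An arc set under \<open>symcl\<close> is only a choice of orientation. Comparing two
  choices edge by edge, in either direction, lets each case orient its edges as convenient.\<close>

lemma symcl_eqI:
  fixes R S :: "'a rel"
  assumes "\<And>u v. (u, v) \<in> R \<Longrightarrow> (u, v) \<in> S \<or> (v, u) \<in> S"
    "\<And>u v. (u, v) \<in> S \<Longrightarrow> (u, v) \<in> R \<or> (v, u) \<in> R"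
  shows "symcl R = symcl S"
proof (rule set_eqI)
  fix e :: "'a \<times> 'a"
  show "e \<in> symcl R \<longleftrightarrow> e \<in> symcl S"
    by (cases e) (use assms in \<open>metis symcl_iff\<close>)
qed

text \<open>The condition rules out loops as well as opposite pairs, so the reversed arcs form a
  disjoint copy of \<open>R\<close>. This converts edge counts into arc counts.\<close>

lemma card_symcl:
  assumes "finite R" "\<And>u v. (u, v) \<in> R \<Longrightarrow> (v, u) \<notin> R"
  shows "card (symcl R) = 2 * card R"
proof -
  have "card ((\<lambda>(a, b). (b, a)) ` R) = card R"
    by (rule card_image) (auto simp: inj_on_def)
  moreover have "R \<inter> (\<lambda>(a, b). (b, a)) ` R = {}" using assms(2) by auto
  ultimately show ?thesis
    unfolding symcl_def using assms(1) by (subst card_Un_disjoint) auto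
qed

lemma map_prod_symcl: "map_prod g g ` symcl R = symcl (map_prod g g ` R)"
  by (auto simp: symcl_def image_Un image_image split_def)

lemma Suc_mod_less: "i < k \<Longrightarrow> Suc i mod k < k"
  by (rule mod_less_divisor) simp

lemma pair_wf_digraph_cycle_pendants: "pair_wf_digraph (cycle_pendants ns)"
  by unfold_locales (auto simp: cycle_pendants_def symcl_def Suc_mod_less)

text \<open>Coordinate-free counterpart of the arcs of \<open>cycle_pendants\<close>: actual
  vertices replace the index pairs, \<open>Ps ! i\<close> is the set of leaves at
  \<open>cs ! i\<close>, and each edge has one orientation.\<close>

definition cycle_arcs :: "'a list \<Rightarrow> 'a set list \<Rightarrow> 'a rel" where
  "cycle_arcs cs Ps = {(cs ! i, cs ! (Suc i mod length cs)) | i. i < length cs} \<union>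
     (\<Union>i<length cs. {cs ! i} \<times> Ps ! i)"

text \<open>Recognition criterion, used in both directions: a cycle with its leaf sets found inside
  \<open>G\<close> proves the isomorphism, and an isomorphism supplies them. Only the sizes of the
  leaf sets matter, since the leaves at one cycle vertex may be numbered arbitrarily.\<close>

lemma graph_iso_cycle_pendants_iff:
  assumes "pair_wf_digraph G"
  shows "graph_iso G (cycle_pendants ns) \<longleftrightarrow>
    (\<exists>cs Ps. map card Ps = ns \<and> (\<forall>P\<in>set Ps. finite P) \<and> length cs = length Ps \<and> distinct cs \<and>
       (\<forall>P\<in>set Ps. P \<inter> set cs = {}) \<and>
       (\<forall>i<length Ps. \<forall>j<length Ps. i \<noteq> j \<longrightarrow> Ps ! i \<inter> Ps ! j = {}) \<and>
       pverts G = set cs \<union> \<Union>(set Ps) \<and> parcs G = symcl (cycle_arcs cs Ps))"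
    (is "?L \<longleftrightarrow> ?R")
proof
  let ?V = "{(i, j). i < length ns \<and> j \<le> ns ! i}"
  assume ?L
  then obtain g where g: "bij_betw g ?V (pverts G)"
    and A: "parcs G = map_prod g g ` parcs (cycle_pendants ns)"
    using graph_iso_iff[OF assms pair_wf_digraph_cycle_pendants]
    by (auto simp: cycle_pendants_def)
  have inj: "inj_on g ?V" using g by (simp add: bij_betw_def)
  have inj': "g (i, j) = g (i', j') \<longleftrightarrow> i = i' \<and> j = j'"
    if "i < length ns" "i' < length ns" "j \<le> ns ! i" "j' \<le> ns ! i'" for i j i' j'
    using inj_onD[OF inj, of "(i, j)" "(i', j')"] that by auto
  define cs where "cs = map (\<lambda>i. g (i, 0)) [0..<length ns]"
  define Ps where "Ps = map (\<lambda>i. (\<lambda>j. g (i, j)) ` {1..ns ! i}) [0..<length ns]"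
  have lcs: "length cs = length ns" by (simp add: cs_def)
  have "map card Ps = ns"
    by (rule nth_equalityI) (auto simp: Ps_def inj' intro!: card_image inj_onI
        trans[OF card_image])
  moreover have "\<forall>P\<in>set Ps. finite P" "length cs = length Ps" "distinct cs"
    by (auto simp: Ps_def cs_def distinct_map inj' intro!: inj_onI)
  moreover have "\<forall>P\<in>set Ps. P \<inter> set cs = {}"
    "\<forall>i<length Ps. \<forall>j<length Ps. i \<noteq> j \<longrightarrow> Ps ! i \<inter> Ps ! j = {}"
    by (auto simp: Ps_def cs_def inj')
  moreover have "?V = (\<Union>i<length ns. {(i, 0)} \<union> Pair i ` {1..ns ! i})"
    by (auto simp: image_iff)
  then have "g ` ?V = set cs \<union> \<Union>(set Ps)"
    by (simp add: image_UN image_Un image_image Ps_def cs_def UN_Un_distrib lessThan_atLeast0) blast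
  then have "pverts G = set cs \<union> \<Union>(set Ps)"
    using g by (simp add: bij_betw_def)
  moreover have "map_prod g g ` ({((i, 0), Suc i mod length ns, 0) |i. i < length ns} \<union>
     {((i, 0), i, j) |i j. i < length ns \<and> 1 \<le> j \<and> j \<le> ns ! i}) = cycle_arcs cs Ps"
    unfolding cycle_arcs_def image_Un
  proof (rule arg_cong2[where f="(\<union>)"])
    show "map_prod g g ` {((i, 0), Suc i mod length ns, 0) |i. i < length ns} =
      {(cs ! i, cs ! (Suc i mod length cs)) |i. i < length cs}"
      by (auto simp: cs_def setcompr_eq_image image_image Suc_mod_less intro!: image_cong)
    have "{((i, 0::nat), i, j) |i j. i < length ns \<and> 1 \<le> j \<and> j \<le> ns ! i} =
       (\<Union>i<length ns. {(i, 0)} \<times> Pair i ` {1..ns ! i})"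
      by (auto simp: image_iff)
    moreover have "map_prod g g ` ({(i, 0)} \<times> Pair i ` {1..ns ! i}) = {cs ! i} \<times> Ps ! i"
      if "i < length ns" for i
      using that by (simp add: map_prod_surj_on[OF refl refl] cs_def Ps_def image_image)
    ultimately show "map_prod g g ` {((i, 0), i, j) |i j. i < length ns \<and> 1 \<le> j \<and> j \<le> ns ! i} =
       (\<Union>i<length cs. {cs ! i} \<times> Ps ! i)"
      by (simp add: image_UN lcs)
  qed
  then have "parcs G = symcl (cycle_arcs cs Ps)"
    unfolding A by (simp add: cycle_pendants_def map_prod_symcl)
  ultimately show ?R by blast
next
  let ?V = "{(i, j). i < length ns \<and> j \<le> ns ! i}"
  assume ?R
  then obtain cs Ps where ns: "map card Ps = ns" and fin: "\<forall>P\<in>set Ps. finite P"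
    and len: "length cs = length Ps" and dist: "distinct cs"
    and disj: "\<forall>P\<in>set Ps. P \<inter> set cs = {}"
      "\<forall>i<length Ps. \<forall>j<length Ps. i \<noteq> j \<longrightarrow> Ps ! i \<inter> Ps ! j = {}"
    and V: "pverts G = set cs \<union> \<Union>(set Ps)" and A: "parcs G = symcl (cycle_arcs cs Ps)"
    by blast
  have k: "length ns = length Ps" "\<And>i. i < length Ps \<Longrightarrow> ns ! i = card (Ps ! i)"
    using ns by auto
  \<comment> \<open>Any numbering of the leaves will do; it starts at 1 because second coordinate 0
    is reserved for the cycle vertex.\<close>
  have "\<exists>e. bij_betw e {1..card (Ps ! i)} (Ps ! i)" if "i < length Ps" for i
    using fin that by (intro ex_bij_betw_nat_finite_1) auto
  then obtain e where e: "\<And>i. i < length Ps \<Longrightarrow> bij_betw (e i) {1..card (Ps ! i)} (Ps ! i)"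
    by metis
  define g where "g = (\<lambda>(i, j). if j = 0 then cs ! i else e i j)"
  have eP: "e i j \<in> Ps ! i" if "i < length Ps" "1 \<le> j" "j \<le> card (Ps ! i)" for i j
    using e[OF that(1)] that by (auto simp: bij_betw_def)
  have notcs: "x \<notin> set cs" if "i < length Ps" "x \<in> Ps ! i" for i x
    using that disj(1) by (meson disjoint_iff nth_mem)
  have gP: "e i ` {1..card (Ps ! i)} = Ps ! i" if "i < length Ps" for i
    using e[OF that] by (simp add: bij_betw_def)
  have "inj_on g ?V"
  proof (rule inj_onI, clarify)
    fix i j i' j'
    assume *: "i < length ns" "j \<le> ns ! i" "i' < length ns" "j' \<le> ns ! i'" "g (i, j) = g (i', j')"
    have **: "e i j \<noteq> cs ! i'" if "j \<noteq> 0" "i < length Ps" "j \<le> card (Ps ! i)" "i' < length Ps" for i j i'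
      using eP[of i j] notcs[of i "e i j"] nth_mem[of i' cs] that len by force
    consider "j = 0" "j' = 0" | "j = 0" "j' \<noteq> 0" | "j \<noteq> 0" "j' = 0" | "j \<noteq> 0" "j' \<noteq> 0" by blast
    then show "i = i' \<and> j = j'"
    proof cases
      case 1
      then show ?thesis using * dist k len by (simp add: g_def nth_eq_iff_index_eq)
    next
      case 2
      then show ?thesis using * **[of j' i' i] k by (auto simp: g_def)
    next
      case 3
      then show ?thesis using * **[of j i i'] k by (auto simp: g_def)
    next
      case 4
      then have "e i j = e i' j'" "e i j \<in> Ps ! i" "e i' j' \<in> Ps ! i'"
        using * k eP[of i j] eP[of i' j'] by (auto simp: g_def)
      then have "i = i'" using disj(2) * k by auto
      moreover have "inj_on (e i) {1..card (Ps ! i)}"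
        using e[of i] * k by (simp add: bij_betw_def)
      ultimately show ?thesis using 4 * k \<open>e i j = e i' j'\<close>
        by (auto dest: inj_onD)
    qed
  qed
  moreover have "?V = (\<Union>i<length ns. {(i, 0)} \<union> Pair i ` {1..ns ! i})"
    by (auto simp: image_iff)
  then have "g ` ?V = (\<Union>i<length Ps. {cs ! i} \<union> e i ` {1..card (Ps ! i)})"
    by (simp add: image_UN image_Un image_image g_def k)
  then have "g ` ?V = (\<Union>i<length Ps. {cs ! i} \<union> Ps ! i)"
    using gP by auto
  then have "g ` ?V = pverts G"
    unfolding V UN_Un_distrib by (auto simp: set_conv_nth len)
  ultimately have "bij_betw g (pverts (cycle_pendants ns)) (pverts G)"
    by (simp add: bij_betw_def cycle_pendants_def)
  moreover have "map_prod g g ` ({((i, 0), Suc i mod length ns, 0) |i. i < length ns} \<union>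
     {((i, 0), i, j) |i j. i < length ns \<and> 1 \<le> j \<and> j \<le> ns ! i}) = cycle_arcs cs Ps"
    unfolding cycle_arcs_def image_Un
  proof (rule arg_cong2[where f="(\<union>)"])
    show "map_prod g g ` {((i, 0), Suc i mod length ns, 0) |i. i < length ns} =
      {(cs ! i, cs ! (Suc i mod length cs)) |i. i < length cs}"
      by (auto simp: g_def k len setcompr_eq_image image_image Suc_mod_less intro!: image_cong)
    have "{((i, 0::nat), i, j) |i j. i < length ns \<and> 1 \<le> j \<and> j \<le> ns ! i} =
       (\<Union>i<length Ps. {(i, 0)} \<times> Pair i ` {1..card (Ps ! i)})"
      by (auto simp: k image_iff)
    moreover have "map_prod g g ` ({(i, 0)} \<times> Pair i ` {1..card (Ps ! i)}) =
       {cs ! i} \<times> e i ` {1..card (Ps ! i)}" for i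
      by (simp add: map_prod_surj_on[OF refl refl] g_def image_image)
    ultimately show "map_prod g g ` {((i, 0), i, j) |i j. i < length ns \<and> 1 \<le> j \<and> j \<le> ns ! i} =
       (\<Union>i<length cs. {cs ! i} \<times> Ps ! i)"
      by (simp add: image_UN len gP del: One_nat_def)
  qed
  then have "parcs G = map_prod g g ` parcs (cycle_pendants ns)"
    unfolding A by (simp add: cycle_pendants_def map_prod_symcl)
  ultimately show ?L
    using graph_iso_iff[OF assms pair_wf_digraph_cycle_pendants] by blast
qed

lemma pair_wf_digraph_triangle_pendants_ext:
  assumes "m \<ge> 1"
  shows "pair_wf_digraph (triangle_pendants_ext t m)"
proof -
  interpret T: pair_wf_digraph "cycle_pendants [m, 0, 0]"
    by (rule pair_wf_digraph_cycle_pendants)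
  have "(0, 1) \<in> pverts (cycle_pendants [m, 0, 0])" "(0, 0) \<in> pverts (cycle_pendants [m, 0, 0])"
    using assms by (auto simp: cycle_pendants_def)
  then show ?thesis
    by unfold_locales
      (auto simp: triangle_pendants_ext_def Let_def symcl_def dest: T.wellformed')
qed

lemma triangle_pendants_ext_simps:
  "pverts (triangle_pendants_ext t m) =
     {(0, 0), (1, 0), (2, 0)} \<union> Pair 0 ` {1..m} \<union> Pair 3 ` {1..t}"
  "parcs (triangle_pendants_ext t m) =
     symcl ({((0, 0), (1, 0)), ((1, 0), (2, 0)), ((2, 0), (0, 0))} \<union>
       {(0, 0)} \<times> Pair 0 ` {1..m} \<union> {(0, 1)} \<times> Pair 3 ` {1..t})"
proof -
  have less3: "i < Suc (Suc (Suc 0)) \<longleftrightarrow> i = 0 \<or> i = 1 \<or> i = 2" for i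
    by auto
  have V: "pverts (cycle_pendants [m, 0, 0]) = {(0, 0), (1, 0), (2, 0)} \<union> Pair 0 ` {1..m}"
    by (auto simp: cycle_pendants_def less3)
  have A: "parcs (cycle_pendants [m, 0, 0]) = 
     symcl ({((0, 0), (1, 0)), ((1, 0), (2, 0)), ((2, 0), (0, 0))} \<union>
       {(0, 0)} \<times> Pair 0 ` {1..m})"
  proof -
    have "{((i, 0::nat), (Suc i mod length [m, 0, 0], 0)) | i. i < length [m, 0, 0]} =
      {((0, 0), (1, 0)), ((1, 0), (2, 0)), ((2, 0), (0, 0::nat))}"
      by (force simp: less3)
    moreover have "{((i, 0::nat), (i, j)) | i j. i < length [m, 0, 0] \<and> 1 \<le> j \<and> j \<le> [m, 0, 0] ! i} =
       {(0, 0)} \<times> Pair 0 ` {1..m}"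
      by (force simp: less3)
    ultimately show ?thesis
      unfolding cycle_pendants_def by simp
  qed
  have T: "{(3::nat, j) | j. 1 \<le> j \<and> j \<le> t} = Pair 3 ` {1..t}"
    "{((0::nat, 1::nat), (3::nat, j)) | j. 1 \<le> j \<and> j \<le> t} = {(0, 1)} \<times> Pair 3 ` {1..t}"
    by auto
  show "pverts (triangle_pendants_ext t m) =
     {(0, 0), (1, 0), (2, 0)} \<union> Pair 0 ` {1..m} \<union> Pair 3 ` {1..t}"
    unfolding triangle_pendants_ext_def Let_def T V by simp
  show "parcs (triangle_pendants_ext t m) =
     symcl ({((0, 0), (1, 0)), ((1, 0), (2, 0)), ((2, 0), (0, 0))} \<union>
       {(0, 0)} \<times> Pair 0 ` {1..m} \<union> {(0, 1)} \<times> Pair 3 ` {1..t})"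
    unfolding triangle_pendants_ext_def Let_def T A
    by (simp only: pair_pre_digraph.select_convs symcl_Un)
qed

text \<open>The model attaches the second-level leaves to \<open>(0, 1)\<close>; by symmetry any
  \<open>d\<close> in \<open>M\<close> can take that place. \<open>M\<close> includes
  \<open>d\<close>, so that its size is the parameter \<open>m\<close>.\<close>

lemma graph_iso_triangle_pendants_ext_iff:
  assumes "pair_wf_digraph G" "m \<ge> 1"
  shows "graph_iso G (triangle_pendants_ext t m) \<longleftrightarrow>
    (\<exists>a b c d M T. card M = m \<and> card T = t \<and> finite M \<and> finite T \<and> distinct [a, b, c] \<and> d \<in> M \<and>
       M \<inter> T = {} \<and> {a, b, c} \<inter> (M \<union> T) = {} \<and> pverts G = {a, b, c} \<union> M \<union> T \<and>
       parcs G = symcl ({(a, b), (b, c), (c, a)} \<union> {a} \<times> M \<union> {d} \<times> T))"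
    (is "?L \<longleftrightarrow> ?R")
proof
  let ?H = "triangle_pendants_ext t m"
  have m: "(0, 1) \<in> Pair (0::nat) ` {1..m}" using assms by simp
  assume ?L
  then obtain g where g: "bij_betw g (pverts ?H) (pverts G)"
    and A: "parcs G = map_prod g g ` parcs ?H"
    using graph_iso_iff[OF assms(1) pair_wf_digraph_triangle_pendants_ext[OF assms(2)]] by blast
  define a b c d where "a = g (0, 0)" and "b = g (1, 0)" and "c = g (2, 0)" and "d = g (0, 1)"
  define M T where "M = g ` Pair 0 ` {1..m}" and "T = g ` Pair 3 ` {1..t}"
  have inj: "inj_on g (pverts ?H)" using g by (simp add: bij_betw_def)
  have eq: "g x = g y \<longleftrightarrow> x = y" if "x \<in> pverts ?H" "y \<in> pverts ?H" for x y
    using inj that by (rule inj_on_eq_iff)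
  have inM: "x \<in> pverts ?H" if "x \<in> Pair 0 ` {1..m}" for x
    using that by (auto simp: triangle_pendants_ext_simps)
  have inT: "x \<in> pverts ?H" if "x \<in> Pair 3 ` {1..t}" for x
    using that by (auto simp: triangle_pendants_ext_simps)
  have in3: "(0, 0) \<in> pverts ?H" "(1, 0) \<in> pverts ?H" "(2, 0) \<in> pverts ?H"
    by (auto simp: triangle_pendants_ext_simps)
  have "card M = card (Pair (0::nat) ` {1..m})" "card T = card (Pair (3::nat) ` {1..t})"
    unfolding M_def T_def by (intro card_image inj_on_subset[OF inj] subsetI inM inT; assumption)+
  then have "card M = m" "card T = t"
    by (simp_all add: card_image inj_on_def)
  moreover have "finite M" "finite T" "d \<in> M"
    using assms by (auto simp: M_def T_def d_def)
  moreover have "distinct [a, b, c]" 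
    using in3 by (auto simp: a_def b_def c_def eq)
  moreover have "M \<inter> T = {}" "{a, b, c} \<inter> (M \<union> T) = {}"
    using inM inT in3 by (auto simp: M_def T_def a_def b_def c_def eq)
  moreover have "pverts G = g ` pverts ?H" using g by (simp add: bij_betw_def)
  then have "pverts G = {a, b, c} \<union> M \<union> T"
    unfolding M_def T_def a_def b_def c_def triangle_pendants_ext_simps by (simp add: image_Un)
  moreover have "parcs G = symcl ({(a, b), (b, c), (c, a)} \<union> {a} \<times> M \<union> {d} \<times> T)"
    unfolding A triangle_pendants_ext_simps map_prod_symcl image_Un
      map_prod_surj_on[OF refl refl] a_def b_def c_def d_def M_def T_def
    by simp
  ultimately show ?R by blast
next
  let ?H = "triangle_pendants_ext t m"
  assume ?R
  then obtain a b c d M T where *: "card M = m" "card T = t" "finite M" "finite T"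
    "distinct [a, b, c]" "d \<in> M" "M \<inter> T = {}" "{a, b, c} \<inter> (M \<union> T) = {}"
    and V: "pverts G = {a, b, c} \<union> M \<union> T"
    and A: "parcs G = symcl ({(a, b), (b, c), (c, a)} \<union> {a} \<times> M \<union> {d} \<times> T)"
    by metis
  \<comment> \<open>Index 1 is reserved for \<open>d\<close>, the image of \<open>(0, 1)\<close>, so
    the rest of \<open>M\<close> is numbered from 2.\<close>
  obtain e where e: "bij_betw e {2..m} (M - {d})"
    using finite_same_card_bij[of "{2..m}" "M - {d}"] * by auto
  obtain e' where e': "bij_betw e' {1..t} T"
    using finite_same_card_bij[of "{1..t}" T] * by auto
  define g where "g = (\<lambda>(i, j). if i = 3 then e' j
     else if i = 0 then if j = 0 then a else if j = 1 then d else e j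
     else if i = (1::nat) then b else c)"
  have m: "{1..m} = insert 1 {2..m}" using assms by auto
  have gM: "g ` Pair 0 ` {1..m} = M"
  proof -
    have "g ` Pair 0 ` {1..m} = insert d (e ` {2..m})"
      unfolding m by (simp add: g_def image_image cong: image_cong_simp)
    also have "\<dots> = M" using e * by (auto simp: bij_betw_def)
    finally show ?thesis .
  qed
  have gT: "g ` Pair 3 ` {1..t} = T"
    using e' by (simp add: g_def image_image bij_betw_def)
  have im: "g ` pverts ?H = pverts G"
    unfolding triangle_pendants_ext_simps V image_Un gM gT by (simp add: g_def)
  have "card {a, b, c} = 3" using * by simp
  \<comment> \<open>\<open>g\<close> is onto, so equal finite cardinalities give injectivity without
    comparing the kinds of vertices pairwise.\<close>
  have "card (pverts G) = card {a, b, c} + card M + card T"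
    unfolding V using * by (subst card_Un_disjoint; (subst card_Un_disjoint)?) auto
  moreover have "card (pverts ?H) = card {(0::nat, 0::nat), (1, 0), (2, 0)} +
      card (Pair (0::nat) ` {1..m}) + card (Pair (3::nat) ` {1..t})"
    unfolding triangle_pendants_ext_simps
    by (subst card_Un_disjoint; (subst card_Un_disjoint)?) auto
  ultimately have "card (pverts G) = card (pverts ?H)"
    using * by (simp add: card_image inj_on_def)
  then have "bij_betw g (pverts ?H) (pverts G)"
    unfolding im[symmetric] bij_betw_def
    by (intro conjI refl eq_card_imp_inj_on) (auto simp: triangle_pendants_ext_simps)
  moreover have "g (0, 0) = a" "g (1, 0) = b" "g (2, 0) = c" "g (0, 1) = d"
    by (auto simp: g_def)
  then have "parcs G = map_prod g g ` parcs ?H"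
    unfolding A triangle_pendants_ext_simps map_prod_symcl image_Un map_prod_surj_on[OF refl refl] gM gT
    by simp
  ultimately show ?L
    using graph_iso_iff[OF assms(1) pair_wf_digraph_triangle_pendants_ext[OF assms(2)]] by blast
qed

section \<open>Distances and eccentricities\<close>

lemma ex_le_relpow_simps:
  fixes R :: "'a rel"
  shows
  "(\<exists>j\<le>0. (u, v) \<in> R ^^ j) \<longleftrightarrow> u = v"
  "(\<exists>j\<le>Suc k. (u, v) \<in> R ^^ j) \<longleftrightarrow> (\<exists>j\<le>k. (u, v) \<in> R ^^ j) \<or> (u, v) \<in> R ^^ Suc k"
proof -
  show "(\<exists>j\<le>0. (u, v) \<in> R ^^ j) \<longleftrightarrow> u = v" by simp
  show "(\<exists>j\<le>Suc k. (u, v) \<in> R ^^ j) \<longleftrightarrow> (\<exists>j\<le>k. (u, v) \<in> R ^^ j) \<or> (u, v) \<in> R ^^ Suc k"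
    by (simp add: le_Suc_eq del: relpow.simps) blast
qed

text \<open>The hypothesis on \<open>u\<close> matters for \<open>k = 0\<close>: the empty walk
  exists only at a vertex of the graph, whereas the zeroth power of a relation contains every
  diagonal pair.\<close>

lemma (in pair_wf_digraph) ex_awalk_iff_relpow:
  assumes "u \<in> pverts G"
  shows "(\<exists>p. awalk u p v \<and> length p = k) \<longleftrightarrow> (u, v) \<in> parcs G ^^ k"
  using assms
proof (induct k arbitrary: u)
  case 0
  then show ?case by (auto simp: awalk_Nil_iff)
next
  case (Suc k)
  have "(\<exists>p. awalk u p v \<and> length p = Suc k) \<longleftrightarrow> (\<exists>w p. (u, w) \<in> parcs G \<and> awalk w p v \<and> length p = k)"
  proof
    assume "\<exists>p. awalk u p v \<and> length p = Suc k"
    then show "\<exists>w p. (u, w) \<in> parcs G \<and> awalk w p v \<and> length p = k"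
      by (auto simp: length_Suc_conv awalk_Cons_iff) blast
  next
    assume "\<exists>w p. (u, w) \<in> parcs G \<and> awalk w p v \<and> length p = k"
    then obtain w p where "(u, w) \<in> parcs G" "awalk w p v" "length p = k" by blast
    then have "awalk u ((u, w) # p) v \<and> length ((u, w) # p) = Suc k"
      by (auto simp: awalk_Cons_iff)
    then show "\<exists>p. awalk u p v \<and> length p = Suc k" by blast
  qed
  also have "\<dots> \<longleftrightarrow> (\<exists>w. (u, w) \<in> parcs G \<and> (w, v) \<in> parcs G ^^ k)"
    using Suc.hyps wellformed' by blast
  also have "\<dots> \<longleftrightarrow> (u, v) \<in> parcs G ^^ Suc k"
    by (meson relpow_Suc_D2 relpow_Suc_I2)
  finally show ?case .
qed

section \<open>Distances in connected symmetric graphs\<close>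

locale connected_pair_graph = pair_graph +
  assumes conn: "Digraph_Component.connected (with_proj G)"
begin

abbreviation adj :: "'a \<Rightarrow> 'a \<Rightarrow> bool" where
  "adj u v \<equiv> (u, v) \<in> parcs G"

lemma adj_sym: "adj u v \<Longrightarrow> adj v u"
  by (rule arcs_symmetric)

lemma awalk_cost_one: "awalk_cost (\<lambda>_. 1) p = real (length p)"
  by (induct p) auto

lemma ex_relpow:
  assumes "u \<in> pverts G" "v \<in> pverts G"
  obtains k where "(u, v) \<in> parcs G ^^ k"
proof -
  have "strongly_connected (with_proj G)"
    using conn sym_arcs by (intro symmetric_connected_imp_strongly_connected) simp_all
  then have "u \<rightarrow>\<^sup>*\<^bsub>with_proj G\<^esub> v"
    using assms by (auto simp: strongly_connected_def)
  then obtain p where "awalk u p v" by (auto simp: reachable_awalk)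
  then show ?thesis using that ex_awalk_iff_relpow[OF assms(1), of v "length p"] by blast
qed

text \<open>With unit costs the cost of a walk is its length, so the infimum is attained by a walk
  of least length and the extended real distance becomes a natural number.\<close>

lemma gdist_eq_Least:
  assumes "u \<in> pverts G" "v \<in> pverts G"
  shows "gdist G u v = real (LEAST k. (u, v) \<in> parcs G ^^ k)"
proof -
  let ?k = "LEAST k. (u, v) \<in> parcs G ^^ k"
  have "(u, v) \<in> parcs G ^^ ?k"
    using ex_relpow[OF assms] by (metis LeastI)
  then obtain p where p: "awalk u p v" "length p = ?k"
    using ex_awalk_iff_relpow[OF assms(1)] by blast
  have le: "?k \<le> length q" if "awalk u q v" for q
    using that ex_awalk_iff_relpow[OF assms(1), of v "length q"] by (blast intro: Least_le)
  have "\<mu> (\<lambda>_. 1) u v = ereal (real ?k)"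
    unfolding \<mu>_def
  proof (rule INF_eqI)
    show "ereal (real ?k) \<le> ereal (awalk_cost (\<lambda>_. 1) q)" if "q \<in> {p. awalk u p v}" for q
      using le[of q] that by (simp add: awalk_cost_one)
    show "y \<le> ereal (real ?k)"
      if "\<And>q. q \<in> {p. awalk u p v} \<Longrightarrow> y \<le> ereal (awalk_cost (\<lambda>_. 1) q)" for y
      using that[of p] p by (simp add: awalk_cost_one)
  qed
  then show ?thesis by (simp add: gdist_def)
qed

lemma gdist_le_iff:
  assumes "u \<in> pverts G" "v \<in> pverts G"
  shows "gdist G u v \<le> real k \<longleftrightarrow> (\<exists>j\<le>k. (u, v) \<in> parcs G ^^ j)"
proof -
  have "(u, v) \<in> parcs G ^^ (LEAST k. (u, v) \<in> parcs G ^^ k)"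
    using ex_relpow[OF assms] by (metis LeastI)
  then show ?thesis
    unfolding gdist_eq_Least[OF assms] by (auto intro: Least_le order_trans)
qed

lemma ecc_le_iff:
  assumes "u \<in> pverts G"
  shows "ecc G u \<le> real k \<longleftrightarrow> (\<forall>v\<in>pverts G. \<exists>j\<le>k. (u, v) \<in> parcs G ^^ j)"
proof -
  have *: "finite {gdist G u v | v. v \<in> pverts G}" "{gdist G u v | v. v \<in> pverts G} \<noteq> {}"
    using assms pair_finite_verts by auto
  show ?thesis
    unfolding ecc_def Max_le_iff[OF *] using gdist_le_iff[OF assms] by auto
qed

text \<open>Integrality is what turns \<open>> 1\<close> into \<open>\<ge> 2\<close> and
  \<open>> 2\<close> into \<open>\<ge> 3\<close> below.\<close>

lemma ecc_nat:
  assumes "u \<in> pverts G"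
  obtains k where "ecc G u = real k"
proof -
  have *: "finite {gdist G u v | v. v \<in> pverts G}" "{gdist G u v | v. v \<in> pverts G} \<noteq> {}"
    using assms pair_finite_verts by auto
  have "ecc G u \<in> {gdist G u v | v. v \<in> pverts G}"
    unfolding ecc_def by (rule Max_in[OF *])
  then show ?thesis using that gdist_eq_Least[OF assms] by auto
qed

definition universal :: "'a \<Rightarrow> bool" where
  "universal u \<longleftrightarrow> (\<forall>v\<in>pverts G. v = u \<or> adj u v)"

definition central :: "'a \<Rightarrow> bool" where
  "central u \<longleftrightarrow> (\<forall>v\<in>pverts G. v = u \<or> adj u v \<or> (\<exists>w. adj u w \<and> adj w v))"

lemma ecc_le_1_iff: "u \<in> pverts G \<Longrightarrow> ecc G u \<le> 1 \<longleftrightarrow> universal u"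
  using ecc_le_iff[of u 1] by (auto simp: universal_def ex_le_relpow_simps)

lemma ecc_le_2_iff: "u \<in> pverts G \<Longrightarrow> ecc G u \<le> 2 \<longleftrightarrow> central u"
  using ecc_le_iff[of u "Suc (Suc 0)"]
  by (auto simp: central_def ex_le_relpow_simps relcomp_unfold)

lemma ecc_le_3I:
  assumes "u \<in> pverts G" 
    "\<And>v. v \<in> pverts G \<Longrightarrow> v = u \<or> adj u v \<or> (\<exists>w. adj u w \<and> adj w v) \<or>
      (\<exists>w x. adj u w \<and> adj w x \<and> adj x v)"
  shows "ecc G u \<le> 3"
proof -
  have "\<exists>j\<le>Suc (Suc (Suc 0)). (u, v) \<in> parcs G ^^ j" if "v \<in> pverts G" for v
    using assms(2)[OF that]
    by (auto simp: ex_le_relpow_simps relcomp_unfold)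
  then show ?thesis using ecc_le_iff[OF assms(1), of "Suc (Suc (Suc 0))"] by auto
qed

lemma ecc_eq_2:
  assumes "u \<in> pverts G" "\<not> universal u" "central u"
  shows "ecc G u = 2"
proof -
  obtain k where k: "ecc G u = real k" using ecc_nat[OF assms(1)] .
  then show ?thesis
    using ecc_le_1_iff[OF assms(1)] ecc_le_2_iff[OF assms(1)] assms by simp
qed

lemma ecc_ge_2:
  assumes "u \<in> pverts G" "\<not> universal u"
  shows "ecc G u \<ge> 2"
proof -
  obtain k where k: "ecc G u = real k" using ecc_nat[OF assms(1)] .
  then show ?thesis
    using ecc_le_1_iff[OF assms(1)] assms by simp
qed

lemma ecc_ge_3:
  assumes "u \<in> pverts G" "\<not> central u"
  shows "ecc G u \<ge> 3"
proof -
  obtain k where k: "ecc G u = real k" using ecc_nat[OF assms(1)] .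
  then show ?thesis
    using ecc_le_2_iff[OF assms(1)] assms by simp
qed

end

section \<open>Breadth-first spanning trees\<close>

context connected_pair_graph
begin

text \<open>The distance from \<open>r\<close> as a natural number, which permits induction over
  levels.\<close>

definition level :: "'a \<Rightarrow> 'a \<Rightarrow> nat" where
  "level r v = (LEAST k. (r, v) \<in> parcs G ^^ k)"

lemma relpow_level: "r \<in> pverts G \<Longrightarrow> v \<in> pverts G \<Longrightarrow> (r, v) \<in> parcs G ^^ level r v"
  unfolding level_def using ex_relpow[of r v] by (metis LeastI)

lemma level_le: "(r, v) \<in> parcs G ^^ k \<Longrightarrow> level r v \<le> k"
  unfolding level_def by (rule Least_le)

lemma level_adj_le: "r \<in> pverts G \<Longrightarrow> adj u v \<Longrightarrow> level r v \<le> Suc (level r u)"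
  using relpow_level[of r u] by (intro level_le) (auto dest: in_arcsD1)

text \<open>Take the last vertex before \<open>v\<close> on a shortest walk: the walk bounds its
  level from above, \<open>level_adj_le\<close> from below.\<close>

lemma ex_parent:
  assumes "r \<in> pverts G" "v \<in> pverts G" "v \<noteq> r"
  shows "\<exists>w. adj v w \<and> level r v = Suc (level r w)"
proof -
  have *: "(r, v) \<in> parcs G ^^ level r v" using assms by (intro relpow_level)
  then obtain k where k: "level r v = Suc k"
    using assms by (cases "level r v") auto
  then obtain w where w: "(r, w) \<in> parcs G ^^ k" "adj w v"
    using * by auto
  then have "level r w \<le> k" "Suc k \<le> Suc (level r w)"
    using level_le level_adj_le[OF assms(1) w(2)] k by auto
  then show ?thesis using w k by (auto intro: adj_sym)
qed

definition tree_arcs :: "'a \<Rightarrow> ('a \<Rightarrow> 'a) \<Rightarrow> 'a rel" where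
  "tree_arcs r p = symcl ((\<lambda>v. (v, p v)) ` (pverts G - {r}))"

text \<open>The level equation makes iterated parents reach the root, and later forces the parents
  of second-level vertices into the first level.\<close>

definition bfs_parent :: "'a \<Rightarrow> ('a \<Rightarrow> 'a) \<Rightarrow> bool" where
  "bfs_parent r p \<longleftrightarrow> r \<in> pverts G \<and>
     (\<forall>v\<in>pverts G - {r}. adj v (p v) \<and> level r v = Suc (level r (p v)))"

lemma ex_bfs_parent: "r \<in> pverts G \<Longrightarrow> \<exists>p. bfs_parent r p"
  unfolding bfs_parent_def using ex_parent[of r] by (auto intro!: bchoice)

lemma tree_arcs_subset: "bfs_parent r p \<Longrightarrow> tree_arcs r p \<subseteq> parcs G"
  by (auto simp: bfs_parent_def tree_arcs_def symcl_def intro: adj_sym)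

lemma tree_arcs_sym: "(u, v) \<in> tree_arcs r p \<Longrightarrow> (v, u) \<in> tree_arcs r p"
  by (auto simp: tree_arcs_def symcl_def)

text \<open>One arc for each vertex other than the root, in two orientations; a union bound is
  enough for an upper estimate.\<close>

lemma card_tree_arcs_le:
  assumes "r \<in> pverts G"
  shows "card (tree_arcs r p) \<le> 2 * (card (pverts G) - 1)"
proof -
  let ?S = "(\<lambda>v. (v, p v)) ` (pverts G - {r})"
  have S: "card ?S \<le> card (pverts G) - 1"
    using card_image_le[of "pverts G - {r}" "\<lambda>v. (v, p v)"] pair_finite_verts assms
    by (simp add: card_Diff_singleton)
  have "card (tree_arcs r p) \<le> card ?S + card ((\<lambda>(a, b). (b, a)) ` ?S)"
    unfolding tree_arcs_def symcl_def by (rule card_Un_le)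
  also have "card ((\<lambda>(a, b). (b, a)) ` ?S) \<le> card ?S"
    by (rule card_image_le) (use pair_finite_verts in simp)
  finally show ?thesis using S by simp
qed

lemma tree_arcs_rtrancl_root:
  assumes "bfs_parent r p" "v \<in> pverts G"
  shows "(v, r) \<in> (tree_arcs r p)\<^sup>*"
  using assms(2)
proof (induct "level r v" arbitrary: v rule: less_induct)
  case less
  show ?case
  proof (cases "v = r")
    case False
    then have "(v, p v) \<in> tree_arcs r p"
      using less.prems by (auto simp: tree_arcs_def symcl_def)
    moreover have "(p v, r) \<in> (tree_arcs r p)\<^sup>*"
      using False less assms(1) by (intro less.hyps) (auto simp: bfs_parent_def dest: in_arcsD2)
    ultimately show ?thesis by (rule converse_rtrancl_into_rtrancl)
  qed simp
qed

text \<open>A tree path from \<open>v\<close> back to \<open>u\<close> closes up with the arc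
  \<open>(u, v)\<close>. The clause on the remaining edges later recovers \<open>{u, v}\<close> from
  the cycle, as its only edge outside the tree.\<close>

lemma fundamental_cycle:
  assumes "bfs_parent r p" "adj u v" "(u, v) \<notin> tree_arcs r p"
  shows "\<exists>C\<in>cycles G. {u, v} \<in> C \<and>
    (\<forall>e\<in>C. e = {u, v} \<or> (\<exists>x y. e = {x, y} \<and> (x, y) \<in> tree_arcs r p))"
proof -
  let ?T = "tree_arcs r p"
  have uv: "u \<in> pverts G" "v \<in> pverts G" "u \<noteq> v"
    using assms(2) by (auto dest: in_arcsD1 in_arcsD2 no_loops')
  \<comment> \<open>The tree arcs form a digraph of their own, so the path extracted by
    \<open>awalk_to_apath\<close> is guaranteed to stay inside the tree.\<close>
  interpret H: pair_wf_digraph "\<lparr>pverts = pverts G, parcs = ?T\<rparr>"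
    using tree_arcs_subset[OF assms(1)]
    by unfold_locales (auto dest!: subsetD intro: in_arcsD1 in_arcsD2)
  have "sym ?T" by (auto intro!: symI tree_arcs_sym)
  then have "(r, u) \<in> ?T\<^sup>*"
    using tree_arcs_rtrancl_root[OF assms(1) uv(1)] by (meson sym_rtrancl symE)
  then have "(v, u) \<in> ?T\<^sup>*"
    using tree_arcs_rtrancl_root[OF assms(1) uv(2)] by (rule rtrancl_trans[rotated])
  then obtain k where "(v, u) \<in> ?T ^^ k" by (auto simp: rtrancl_power)
  then obtain q where "H.awalk v q u"
    using H.ex_awalk_iff_relpow[of v u k] uv by auto
  then have "H.apath v (H.awalk_to_apath q) u"
    by (rule H.apath_awalk_to_apath)
  then obtain q where q: "H.apath v q u" by blast
  have "set q \<subseteq> ?T" and cas: "pcas v q u" and dist: "distinct (pawalk_verts v q)"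
    using q by (auto simp: H.apath_def H.awalk_def)
  then have "awalk v q u"
    using uv tree_arcs_subset[OF assms(1)] by (auto simp: awalk_def)
  then have aw: "awalk u ((u, v) # q) u"
    using assms(2) by (simp add: awalk_Cons_iff)
  have "cycle ((u, v) # q)"
    unfolding cycle_def using aw dist by (intro exI[of _ u]) simp
  \<comment> \<open>The path is not empty since \<open>u \<noteq> v\<close>, and not a single arc,
    since that arc would be \<open>(v, u)\<close>, which lies outside the tree by symmetry.\<close>
  moreover have "length ((u, v) # q) \<ge> 3"
  proof -
    have "q \<noteq> []" using cas uv by auto
    moreover have "q \<noteq> [e]" for e
      using cas \<open>set q \<subseteq> ?T\<close> assms(3) tree_arcs_sym[of v u r p] by (cases e) auto
    ultimately show ?thesis by (cases q; cases "tl q") auto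
  qed
  ultimately have "(\<lambda>(u, v). {u, v}) ` set ((u, v) # q) \<in> cycles G"
    unfolding cycles_def by blast
  then show ?thesis
    using \<open>set q \<subseteq> ?T\<close> by (intro bexI) auto
qed

end

section \<open>Uniqueness of the edge outside the tree\<close>

locale at_most_unicyclic_graph = connected_pair_graph +
  assumes unique_cycle: "C \<in> cycles G \<Longrightarrow> D \<in> cycles G \<Longrightarrow> C = D"
begin

text \<open>The fundamental cycles of \<open>uv\<close> and \<open>xy\<close> coincide, so the
  latter contains \<open>{u, v}\<close>; but all its edges other than \<open>{x, y}\<close> lie in
  the tree.\<close>

lemma extra_edge_unique:
  assumes "bfs_parent r p" "adj u v" "(u, v) \<notin> tree_arcs r p" "adj x y" "(x, y) \<notin> tree_arcs r p"
  shows "{u, v} = {x, y}"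
proof -
  obtain C where C: "C \<in> cycles G" "{u, v} \<in> C"
    using fundamental_cycle[OF assms(1-3)] by blast
  obtain D where D: "D \<in> cycles G"
    "\<forall>e\<in>D. e = {x, y} \<or> (\<exists>a b. e = {a, b} \<and> (a, b) \<in> tree_arcs r p)"
    using fundamental_cycle[OF assms(1,4,5)] by blast
  have "{u, v} \<in> D" using unique_cycle[OF C(1) D(1)] C by simp
  from bspec[OF D(2) this] show ?thesis
    using assms(3) tree_arcs_sym[of v u r p] by (auto simp: doubleton_eq_iff)
qed

lemma arcs_cases:
  assumes p: "bfs_parent r p"
  obtains (tree) "parcs G = tree_arcs r p"
    | (extra) x y where "adj x y" "(x, y) \<notin> tree_arcs r p" "parcs G = tree_arcs r p \<union> {(x, y), (y, x)}"
proof (cases "parcs G = tree_arcs r p")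
  case False
  then obtain x y where xy: "adj x y" "(x, y) \<notin> tree_arcs r p"
    using tree_arcs_subset[OF p] by auto
  have "parcs G \<subseteq> tree_arcs r p \<union> {(x, y), (y, x)}"
  proof
    fix e assume e: "e \<in> parcs G"
    obtain u v where [simp]: "e = (u, v)" by (cases e)
    show "e \<in> tree_arcs r p \<union> {(x, y), (y, x)}"
      using extra_edge_unique[OF p _ _ xy, of u v] e
      by (auto simp: doubleton_eq_iff)
  qed
  then show ?thesis
    using extra[OF xy] xy tree_arcs_subset[OF p] adj_sym by blast
qed (rule tree)

lemma card_arcs_le:
  assumes "pverts G \<noteq> {}"
  shows "card (parcs G) \<le> 2 * card (pverts G)"
proof -
  obtain r where r: "r \<in> pverts G" using assms by blast
  obtain p where p: "bfs_parent r p" using ex_bfs_parent[OF r] by blast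
  \<comment> \<open>Subtraction on naturals is truncated: \<open>2 * (n - 1) + 2 = 2 * n\<close>
    relies on this.\<close>
  have n: "card (pverts G) \<ge> 1"
    using r pair_finite_verts by (metis One_nat_def Suc_leI card_gt_0_iff empty_iff)
  show ?thesis
    using p
  proof (cases rule: arcs_cases)
    case tree
    then show ?thesis using card_tree_arcs_le[OF r, of p] by simp
  next
    case (extra x y)
    have "card (parcs G) \<le> card (tree_arcs r p) + card {(x, y), (y, x)}"
      unfolding extra(3) by (rule card_Un_le)
    also have "card {(x, y), (y, x)} \<le> 2"
      using card_insert_le_m1[of 2 "{(y, x)}" "(x, y)"] by simp
    finally show ?thesis using card_tree_arcs_le[OF r, of p] n by linarith
  qed
qed

end

section \<open>Short cycles with pendent vertices\<close>

lemma cycle_arcs_3: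
  "cycle_arcs [v0, v1, v2] [P, Q, R] =
    {(v0, v1), (v1, v2), (v2, v0)} \<union> {v0} \<times> P \<union> {v1} \<times> Q \<union> {v2} \<times> R"
  by (auto simp: cycle_arcs_def setcompr_eq_image lessThan_Suc simp flip: lessThan_def)

lemma cycle_arcs_4:
  "cycle_arcs [v0, v1, v2, v3] [P, Q, R, S] =
    {(v0, v1), (v1, v2), (v2, v3), (v3, v0)} \<union> {v0} \<times> P \<union> {v1} \<times> Q \<union> {v2} \<times> R \<union> {v3} \<times> S"
  by (auto simp: cycle_arcs_def setcompr_eq_image lessThan_Suc simp flip: lessThan_def)

lemma cycle_arcs_5:
  "cycle_arcs [v0, v1, v2, v3, v4] [P, Q, R, S, T] =
    {(v0, v1), (v1, v2), (v2, v3), (v3, v4), (v4, v0)} \<union>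
    {v0} \<times> P \<union> {v1} \<times> Q \<union> {v2} \<times> R \<union> {v3} \<times> S \<union> {v4} \<times> T"
  by (auto simp: cycle_arcs_def setcompr_eq_image lessThan_Suc simp flip: lessThan_def)

lemma graph_iso_triangle_pendants:
  assumes "pair_wf_digraph G" "finite P" "finite Q" "finite R" "distinct [v0, v1, v2]"
    "{v0, v1, v2} \<inter> (P \<union> Q \<union> R) = {}" "P \<inter> Q = {}" "P \<inter> R = {}" "Q \<inter> R = {}"
    "pverts G = {v0, v1, v2} \<union> P \<union> Q \<union> R"
    "parcs G = symcl ({(v0, v1), (v1, v2), (v2, v0)} \<union> {v0} \<times> P \<union> {v1} \<times> Q \<union> {v2} \<times> R)"
  shows "graph_iso G (cycle_pendants [card P, card Q, card R])"
  unfolding graph_iso_cycle_pendants_iff[OF assms(1)]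
  using assms(2-)
  by (intro exI[of _ "[v0, v1, v2]"] exI[of _ "[P, Q, R]"])
    (auto simp: cycle_arcs_3 less_Suc_eq)

lemma graph_iso_quadrangle_pendants:
  assumes "pair_wf_digraph G" "finite P" "finite Q"
    "distinct [v0, v1, v2, v3]" "{v0, v1, v2, v3} \<inter> (P \<union> Q) = {}" "P \<inter> Q = {}"
    "pverts G = {v0, v1, v2, v3} \<union> P \<union> Q"
    "parcs G = symcl ({(v0, v1), (v1, v2), (v2, v3), (v3, v0)} \<union> {v0} \<times> P \<union> {v1} \<times> Q)"
  shows "graph_iso G (cycle_pendants [card P, card Q, 0, 0])"
  unfolding graph_iso_cycle_pendants_iff[OF assms(1)]
  using assms(2-)
  by (intro exI[of _ "[v0, v1, v2, v3]"] exI[of _ "[P, Q, {}, {}]"])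
    (auto simp: cycle_arcs_4 less_Suc_eq)

lemma graph_iso_quadrangle_pendantsE:
  assumes "pair_wf_digraph G" "graph_iso G (cycle_pendants [n1, n2, 0, 0])"
  obtains v0 v1 v2 v3 P Q where "card P = n1" "card Q = n2" "finite P" "finite Q"
    "distinct [v0, v1, v2, v3]" "{v0, v1, v2, v3} \<inter> (P \<union> Q) = {}" "P \<inter> Q = {}"
    "pverts G = {v0, v1, v2, v3} \<union> P \<union> Q"
    "parcs G = symcl ({(v0, v1), (v1, v2), (v2, v3), (v3, v0)} \<union> {v0} \<times> P \<union> {v1} \<times> Q)"
proof -
  obtain cs Ps where *: "map card Ps = [n1, n2, 0, 0]" "\<forall>P\<in>set Ps. finite P"
    "length cs = length Ps" "distinct cs" "\<forall>P\<in>set Ps. P \<inter> set cs = {}"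
    "\<forall>i<length Ps. \<forall>j<length Ps. i \<noteq> j \<longrightarrow> Ps ! i \<inter> Ps ! j = {}"
    "pverts G = set cs \<union> \<Union>(set Ps)" "parcs G = symcl (cycle_arcs cs Ps)"
    using assms(2) unfolding graph_iso_cycle_pendants_iff[OF assms(1)] by (elim exE conjE that)
  have "length Ps = 4" using arg_cong[OF *(1), of length] by simp
  then obtain P Q R S v0 v1 v2 v3 where Ps: "Ps = [P, Q, R, S]" and cs: "cs = [v0, v1, v2, v3]"
    using *(3) by (auto simp: length_Suc_conv numeral_eq_Suc)
  \<comment> \<open>\<open>card\<close> is 0 for infinite sets too, so finiteness enters the
    conclusion that these leaf sets are empty.\<close>
  have RS: "R = {}" "S = {}" using *(1,2) by (auto simp: Ps)
  show thesis
  proof (rule that)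
    show "card P = n1" "card Q = n2" "finite P" "finite Q"
      using *(1,2) by (auto simp: Ps)
    show "distinct [v0, v1, v2, v3]" using *(4) by (simp only: cs)
    show "{v0, v1, v2, v3} \<inter> (P \<union> Q) = {}" using *(5) by (auto simp: Ps cs)
    show "P \<inter> Q = {}" using *(6)[rule_format, of 0 1] by (simp add: Ps)
    show "pverts G = {v0, v1, v2, v3} \<union> P \<union> Q"
      unfolding *(7) Ps cs RS by auto
    show "parcs G = symcl ({(v0, v1), (v1, v2), (v2, v3), (v3, v0)} \<union> {v0} \<times> P \<union> {v1} \<times> Q)"
      unfolding *(8) Ps cs cycle_arcs_4 RS by simp
  qed
qed

lemma graph_iso_pentagon_pendants:
  assumes "pair_wf_digraph G" "finite P"
    "distinct [v0, v1, v2, v3, v4]" "{v0, v1, v2, v3, v4} \<inter> P = {}"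
    "pverts G = {v0, v1, v2, v3, v4} \<union> P"
    "parcs G = symcl ({(v0, v1), (v1, v2), (v2, v3), (v3, v4), (v4, v0)} \<union> {v0} \<times> P)"
  shows "graph_iso G (cycle_pendants [card P, 0, 0, 0, 0])"
  unfolding graph_iso_cycle_pendants_iff[OF assms(1)]
  using assms(2-)
  by (intro exI[of _ "[v0, v1, v2, v3, v4]"] exI[of _ "[P, {}, {}, {}, {}]"])
    (auto simp: cycle_arcs_5 less_Suc_eq)

lemma graph_iso_pentagon_pendantsE:
  assumes "pair_wf_digraph G" "graph_iso G (cycle_pendants [m, 0, 0, 0, 0])"
  obtains v0 v1 v2 v3 v4 P where "card P = m" "finite P"
    "distinct [v0, v1, v2, v3, v4]" "{v0, v1, v2, v3, v4} \<inter> P = {}"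
    "pverts G = {v0, v1, v2, v3, v4} \<union> P"
    "parcs G = symcl ({(v0, v1), (v1, v2), (v2, v3), (v3, v4), (v4, v0)} \<union> {v0} \<times> P)"
proof -
  obtain cs Ps where *: "map card Ps = [m, 0, 0, 0, 0]" "\<forall>P\<in>set Ps. finite P"
    "length cs = length Ps" "distinct cs" "\<forall>P\<in>set Ps. P \<inter> set cs = {}"
    "\<forall>i<length Ps. \<forall>j<length Ps. i \<noteq> j \<longrightarrow> Ps ! i \<inter> Ps ! j = {}"
    "pverts G = set cs \<union> \<Union>(set Ps)" "parcs G = symcl (cycle_arcs cs Ps)"
    using assms(2) unfolding graph_iso_cycle_pendants_iff[OF assms(1)] by (elim exE conjE that)
  have "length Ps = 5" using arg_cong[OF *(1), of length] by simp
  then obtain P Q R S T v0 v1 v2 v3 v4 where Ps: "Ps = [P, Q, R, S, T]"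
    and cs: "cs = [v0, v1, v2, v3, v4]"
    using *(3) by (auto simp: length_Suc_conv numeral_eq_Suc)
  have QRST: "Q = {}" "R = {}" "S = {}" "T = {}" using *(1,2) by (auto simp: Ps)
  show thesis
  proof (rule that)
    show "card P = m" "finite P"
      using *(1,2) by (auto simp: Ps)
    show "distinct [v0, v1, v2, v3, v4]" using *(4) by (simp only: cs)
    show "{v0, v1, v2, v3, v4} \<inter> P = {}" using *(5) by (auto simp: Ps cs)
    show "pverts G = {v0, v1, v2, v3, v4} \<union> P"
      unfolding *(7) Ps cs QRST by auto
    show "parcs G = symcl ({(v0, v1), (v1, v2), (v2, v3), (v3, v4), (v4, v0)} \<union> {v0} \<times> P)"
      unfolding *(8) Ps cs cycle_arcs_5 QRST by simp
  qed
qed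

section \<open>Edge contributions\<close>

lemma abc_f_commute: "abc_f x y = abc_f y x"
  by (simp add: abc_f_def algebra_simps)

text \<open>Since (2 + y - 2) / (2 y) = 1/2, an edge with an end of eccentricity 2 contributes the
  same whatever its other end. Positivity excludes division by zero.\<close>

lemma abc_f_2: "y > 0 \<Longrightarrow> abc_f 2 y = sqrt (1 / 2)"
  by (simp add: abc_f_def)

lemma abc_f_3_3: "abc_f 3 3 = 2 / 3"
proof -
  have "abc_f 3 3 = sqrt ((2 / 3)\<^sup>2)" by (simp add: abc_f_def power2_eq_square)
  then show ?thesis by (simp only: real_sqrt_abs)
qed

lemma sqrt_half_gt: "2 / 3 < sqrt (1 / 2)"
  by (rule real_less_rsqrt) (simp add: power2_eq_square)

lemma abc_f_le:
  assumes "x \<ge> 2" "y \<ge> 2"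
  shows "abc_f x y \<le> sqrt (1 / 2)"
proof -
  \<comment> \<open>Clearing denominators leaves \<open>2 * (x + y - 2) \<le> x * y\<close>, which
    is this product rearranged.\<close>
  have "0 \<le> (x - 2) * (y - 2)" using assms by simp
  then have "(x + y - 2) / (x * y) \<le> 1 / 2"
    using assms by (simp add: field_simps)
  then show ?thesis unfolding abc_f_def by (rule real_sqrt_le_mono)
qed

lemma abc_f_le_3_3:
  assumes "x \<ge> 3" "y \<ge> 3"
  shows "abc_f x y \<le> abc_f 3 3"
proof -
  \<comment> \<open>The claim amounts to \<open>9 * (x + y - 2) \<le> 4 * x * y\<close>; multiplying
    by 4 and completing the product gives this inequality.\<close>
  have "3 * 3 \<le> (4 * x - 9) * (4 * y - 9)"
    using assms by (intro mult_mono) auto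
  then have "(x + y - 2) / (x * y) \<le> (3 + 3 - 2) / (3 * 3)"
    using assms by (simp add: field_simps)
  then show ?thesis unfolding abc_f_def by (rule real_sqrt_le_mono)
qed

section \<open>Arcs without a central end\<close>

context connected_pair_graph
begin

text \<open>A set of arcs, to match the sum in \<open>ABC3\<close>; every far edge counts twice,
  whence the threshold 4 for two far edges.\<close>

definition far_arcs :: "'a rel" where
  "far_arcs = {(u, v). adj u v \<and> \<not> central u \<and> \<not> central v}"

lemma far_arcs_subset: "far_arcs \<subseteq> parcs G"
  by (auto simp: far_arcs_def)

text \<open>Every arc is charged \<open>sqrt (1 / 2)\<close>, and each far arc gives back at least
  the difference to \<open>abc_f 3 3\<close>.\<close>

lemma ABC3_le:
  assumes nu: "\<And>u. u \<in> pverts G \<Longrightarrow> \<not> universal u"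
  shows "2 * ABC3 G \<le> real (card (parcs G)) * sqrt (1 / 2) -
    real (card far_arcs) * (sqrt (1 / 2) - 2 / 3)"
proof -
  let ?f = "\<lambda>(u, v). abc_f (ecc G u) (ecc G v)"
  have fin: "finite (parcs G)" "finite far_arcs"
    using pair_finite_arcs finite_subset[OF far_arcs_subset pair_finite_arcs] by auto
  have "2 * ABC3 G = sum ?f (parcs G)"
    by (simp add: ABC3_def)
  also have "\<dots> = sum ?f (parcs G - far_arcs) + sum ?f far_arcs"
    by (rule sum.subset_diff[OF far_arcs_subset fin(1)])
  also have "sum ?f (parcs G - far_arcs) \<le> real (card (parcs G - far_arcs)) * sqrt (1 / 2)"
  proof (rule sum_bounded_above)
    fix e assume "e \<in> parcs G - far_arcs"
    then show "?f e \<le> sqrt (1 / 2)"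
      using nu by (cases e) (auto intro!: abc_f_le ecc_ge_2 dest: in_arcsD1 in_arcsD2)
  qed
  also have "sum ?f far_arcs \<le> real (card far_arcs) * abc_f 3 3"
  proof (rule sum_bounded_above)
    fix e assume "e \<in> far_arcs"
    then show "?f e \<le> abc_f 3 3"
      by (cases e) (auto simp: far_arcs_def intro!: abc_f_le_3_3 ecc_ge_3 dest: in_arcsD1 in_arcsD2)
  qed
  finally have "2 * ABC3 G \<le> real (card (parcs G - far_arcs)) * sqrt (1 / 2) + real (card far_arcs) * (2 / 3)"
    by (simp add: abc_f_3_3)
  moreover have "real (card (parcs G - far_arcs)) = real (card (parcs G)) - real (card far_arcs)"
    using card_mono[OF fin(1) far_arcs_subset] by (simp add: card_Diff_subset[OF fin(2) far_arcs_subset])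
  ultimately show ?thesis by (simp add: algebra_simps)
qed

text \<open>With \<open>s = sqrt (1 / 2)\<close>, twice the target is
  \<open>2 * (n - 1) * s + 4 / 3\<close>. At most \<open>n - 1\<close> edges leave a gap of at least
  4/3; at most \<open>n\<close> edges with four far arcs leave a gap of at least
  \<open>2 * s - 4 / 3\<close>, positive because \<open>2 / 3 < s\<close>.\<close>

lemma ABC3_less:
  assumes nu: "\<And>u. u \<in> pverts G \<Longrightarrow> \<not> universal u"
    and "card (parcs G) \<le> 2 * (card (pverts G) - 1) \<or>
      card (parcs G) \<le> 2 * card (pverts G) \<and> card far_arcs \<ge> 4"
    and n: "card (pverts G) \<ge> 1"
  shows "ABC3 G < (real (card (pverts G)) - 1) * sqrt (1 / 2) + abc_f 3 3"
  using assms(2)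
proof
  let ?s = "sqrt (1 / 2)"
  assume "card (parcs G) \<le> 2 * (card (pverts G) - 1)"
  then have "card (parcs G) + 2 \<le> 2 * card (pverts G)" using n by linarith
  then have "real (card (parcs G) + 2) \<le> real (2 * card (pverts G))" by (rule of_nat_mono)
  then have "real (card (parcs G)) \<le> 2 * (real (card (pverts G)) - 1)" by simp
  then have "real (card (parcs G)) * ?s \<le> 2 * (real (card (pverts G)) - 1) * ?s"
    by (rule mult_right_mono) simp
  moreover have "0 \<le> real (card far_arcs) * (?s - 2 / 3)" using sqrt_half_gt by simp
  ultimately have "2 * ABC3 G \<le> 2 * (real (card (pverts G)) - 1) * ?s"
    using ABC3_le[OF nu] by linarith
  then show ?thesis by (simp add: abc_f_3_3 algebra_simps)
next
  let ?s = "sqrt (1 / 2)"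
  assume *: "card (parcs G) \<le> 2 * card (pverts G) \<and> card far_arcs \<ge> 4"
  then have "real (card (parcs G)) \<le> real (2 * card (pverts G))" by (intro of_nat_mono) simp
  then have "real (card (parcs G)) \<le> 2 * real (card (pverts G))" by simp
  then have "real (card (parcs G)) * ?s \<le> 2 * real (card (pverts G)) * ?s"
    by (rule mult_right_mono) simp
  moreover have "4 * (?s - 2 / 3) \<le> real (card far_arcs) * (?s - 2 / 3)"
    using sqrt_half_gt * by (intro mult_right_mono) auto
  ultimately have "2 * ABC3 G \<le> 2 * real (card (pverts G)) * ?s - 4 * (?s - 2 / 3)"
    using ABC3_le[OF nu] by linarith
  moreover have "\<dots> < 2 * ((real (card (pverts G)) - 1) * ?s + 2 / 3)"
    using sqrt_half_gt by (simp add: algebra_simps)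
  ultimately have "2 * ABC3 G < 2 * ((real (card (pverts G)) - 1) * ?s + 2 / 3)"
    by (rule le_less_trans)
  then show ?thesis by (simp only: abc_f_3_3 mult_less_cancel_left_pos zero_less_numeral)
qed

lemma card_far_arcs_ge_4:
  assumes "(u, v) \<in> far_arcs" "(x, y) \<in> far_arcs" "{u, v} \<noteq> {x, y}"
  shows "card far_arcs \<ge> 4"
proof -
  have "u \<noteq> v" "x \<noteq> y" using assms by (auto simp: far_arcs_def dest: no_loops')
  then have "card {(u, v), (v, u), (x, y), (y, x)} = 4"
    using assms(3) by (auto simp: card_insert_if)
  moreover have "{(u, v), (v, u), (x, y), (y, x)} \<subseteq> far_arcs"
    using assms(1,2) by (auto simp: far_arcs_def intro: adj_sym)
  moreover have "finite far_arcs"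
    by (rule finite_subset[OF far_arcs_subset pair_finite_arcs])
  ultimately show ?thesis by (metis card_mono)
qed

text \<open>On every edge other than \<open>pq\<close> the central end has eccentricity exactly 2,
  being non-universal, so the estimate for that edge is attained.\<close>

lemma ABC3_eq:
  assumes nu: "\<And>u. u \<in> pverts G \<Longrightarrow> \<not> universal u"
    and card: "card (parcs G) = 2 * card (pverts G)"
    and pq: "adj p q" "ecc G p = 3" "ecc G q = 3"
    and central: "\<And>u v. adj u v \<Longrightarrow> {u, v} \<noteq> {p, q} \<Longrightarrow> central u \<or> central v"
  shows "ABC3 G = (real (card (pverts G)) - 1) * sqrt (1 / 2) + abc_f 3 3"
proof -
  let ?f = "\<lambda>(u, v). abc_f (ecc G u) (ecc G v)"
  let ?S = "{(p, q), (q, p)}"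
  have "p \<noteq> q" using pq by (auto dest: no_loops')
  have S: "?S \<subseteq> parcs G" using pq by (auto intro: adj_sym)
  have "2 * ABC3 G = sum ?f (parcs G)"
    by (simp add: ABC3_def)
  also have "\<dots> = sum ?f (parcs G - ?S) + sum ?f ?S"
    by (rule sum.subset_diff[OF S pair_finite_arcs])
  also have "sum ?f ?S = 2 * abc_f 3 3"
    using \<open>p \<noteq> q\<close> pq by simp
  also have "sum ?f (parcs G - ?S) = (\<Sum>e\<in>parcs G - ?S. sqrt (1 / 2))"
  proof (rule sum.cong[OF refl])
    fix e assume e: "e \<in> parcs G - ?S"
    obtain u v where [simp]: "e = (u, v)" by (cases e)
    have uv: "u \<in> pverts G" "v \<in> pverts G" using e by (auto dest: in_arcsD1 in_arcsD2)
    have pos: "ecc G u > 0" "ecc G v > 0"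
      using ecc_ge_2[OF uv(1) nu[OF uv(1)]] ecc_ge_2[OF uv(2) nu[OF uv(2)]] by auto
    have "central u \<or> central v"
      using e by (intro central) (auto simp: doubleton_eq_iff)
    then show "?f e = sqrt (1 / 2)"
    proof
      assume "central u"
      then have "ecc G u = 2" using uv nu by (intro ecc_eq_2) auto
      then show ?thesis using pos by (simp only: \<open>e = _\<close> prod.case abc_f_2)
    next
      assume "central v"
      then have "ecc G v = 2" using uv nu by (intro ecc_eq_2) auto
      then show ?thesis using pos
        by (simp only: \<open>e = _\<close> prod.case abc_f_2 abc_f_commute[of "ecc G u"])
    qed
  qed
  also have "\<dots> = (2 * real (card (pverts G)) - 2) * sqrt (1 / 2)"
  proof -
    have "card (parcs G - ?S) = card (parcs G) - 2"
      using \<open>p \<noteq> q\<close> S by (simp add: card_Diff_subset)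
    moreover have "2 \<le> card (parcs G)"
      using card_mono[OF pair_finite_arcs S] \<open>p \<noteq> q\<close> by simp
    ultimately show ?thesis using card by (simp add: of_nat_diff)
  qed
  finally show ?thesis by (simp add: algebra_simps)
qed

end

section \<open>Graphs with a central vertex\<close>

context connected_pair_graph
begin

text \<open>Common goal of all cases. The graphs excluded in the theorem are among the alternatives
  and are discarded only once, at the very end.\<close>

definition small_or_listed :: bool where
  "small_or_listed \<longleftrightarrow>
     (let n = card (pverts G) in
      ABC3 G < (real n - 1) * sqrt (1 / 2) + abc_f 3 3 \<or>
      graph_iso G (cycle_pendants [n - 4, 0, 0, 0]) \<or>
      (\<exists>n1 n2 n3. n1 + n2 + n3 = n - 3 \<and> graph_iso G (cycle_pendants [n1, n2, n3])) \<or>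
      graph_iso G (cycle_pendants [n - 5, 0, 0, 0, 0]) \<or>
      (\<exists>n1 n2. n1 \<ge> 1 \<and> n2 \<ge> 1 \<and> n1 + n2 = n - 4 \<and> graph_iso G (cycle_pendants [n1, n2, 0, 0])) \<or>
      (\<exists>t m. t \<ge> 1 \<and> m \<ge> 1 \<and> m + t = n - 3 \<and> graph_iso G (triangle_pendants_ext t m)))"

lemma listed_triangle:
  assumes "distinct [v0, v1, v2]"
    "{v0, v1, v2} \<inter> (P \<union> Q \<union> R) = {}" "P \<inter> Q = {}" "P \<inter> R = {}" "Q \<inter> R = {}"
    "pverts G = {v0, v1, v2} \<union> P \<union> Q \<union> R"
    "parcs G = symcl ({(v0, v1), (v1, v2), (v2, v0)} \<union> {v0} \<times> P \<union> {v1} \<times> Q \<union> {v2} \<times> R)"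
  shows small_or_listed
proof -
  have fin: "finite P" "finite Q" "finite R" "finite {v0, v1, v2}"
    using pair_finite_verts by (simp_all add: assms(6))
  have "graph_iso G (cycle_pendants [card P, card Q, card R])"
    by (rule graph_iso_triangle_pendants[OF pair_wf_digraph fin(1-3) assms])
  moreover have "card (pverts G) = card {v0, v1, v2} + card P + card Q + card R"
  proof -
    have "({v0, v1, v2} \<union> P \<union> Q) \<inter> R = {}" "({v0, v1, v2} \<union> P) \<inter> Q = {}" "{v0, v1, v2} \<inter> P = {}"
      using assms(2-5) by blast+
    then show ?thesis
      unfolding assms(6) using fin by (simp only: card_Un_disjoint finite_UnI)
  qed
  moreover have "card {v0, v1, v2} = 3" using assms(1) by simp
  ultimately have "card P + card Q + card R = card (pverts G) - 3 \<and>
      graph_iso G (cycle_pendants [card P, card Q, card R])"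
    by simp
  then show ?thesis unfolding small_or_listed_def Let_def by blast
qed

text \<open>An empty leaf set leads to the excluded graph with all leaves at one vertex, two
  nonempty ones to an extremal graph. The same configurations produce both, so they are recognised
  together.\<close>

lemma listed_quadrangle:
  assumes "distinct [v0, v1, v2, v3]" "{v0, v1, v2, v3} \<inter> (P \<union> Q) = {}" "P \<inter> Q = {}"
    "pverts G = {v0, v1, v2, v3} \<union> P \<union> Q"
    "parcs G = symcl ({(v0, v1), (v1, v2), (v2, v3), (v3, v0)} \<union> {v0} \<times> P \<union> {v1} \<times> Q)"
  shows small_or_listed
proof -
  have fin: "finite P" "finite Q" "finite {v0, v1, v2, v3}"
    using pair_finite_verts by (simp_all add: assms(4))
  have iso: "graph_iso G (cycle_pendants [card P, card Q, 0, 0])"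
    by (rule graph_iso_quadrangle_pendants[OF pair_wf_digraph fin(1,2) assms])
  \<comment> \<open>With \<open>P\<close> empty the cycle is rotated by one step, so that the vertex
    carrying \<open>Q\<close> comes first.\<close>
  have iso': "graph_iso G (cycle_pendants [card Q, card P, 0, 0])" if "P = {}"
  proof (rule graph_iso_quadrangle_pendants[OF pair_wf_digraph fin(2,1)])
    show "distinct [v1, v2, v3, v0]" using assms(1) by auto
    show "{v1, v2, v3, v0} \<inter> (Q \<union> P) = {}" "Q \<inter> P = {}" using assms(2) that by blast+
    show "pverts G = {v1, v2, v3, v0} \<union> Q \<union> P" unfolding assms(4) by blast
    show "parcs G = symcl ({(v1, v2), (v2, v3), (v3, v0), (v0, v1)} \<union> {v1} \<times> Q \<union> {v2} \<times> P)"
      unfolding assms(5) that by (simp add: insert_commute)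
  qed
  have "card (pverts G) = card {v0, v1, v2, v3} + card P + card Q"
  proof -
    have "({v0, v1, v2, v3} \<union> P) \<inter> Q = {}" "{v0, v1, v2, v3} \<inter> P = {}"
      using assms(2-3) by blast+
    then show ?thesis
      unfolding assms(4) using fin by (simp only: card_Un_disjoint finite_UnI)
  qed
  moreover have "card {v0, v1, v2, v3} = 4" using assms(1) by simp
  ultimately have n: "card P + card Q = card (pverts G) - 4" by simp
  consider "Q = {}" | "P = {}" | "P \<noteq> {}" "Q \<noteq> {}" by blast
  then show ?thesis
  proof cases
    case 1
    then show ?thesis using iso n unfolding small_or_listed_def Let_def by simp
  next
    case 2
    then show ?thesis using iso' n unfolding small_or_listed_def Let_def by simp
  next
    case 3
    then have "card P \<ge> 1" "card Q \<ge> 1" using fin by (simp_all add: Suc_le_eq card_gt_0_iff)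
    then show ?thesis using iso n unfolding small_or_listed_def Let_def by blast
  qed
qed

lemma listed_pentagon:
  assumes "distinct [v0, v1, v2, v3, v4]" "{v0, v1, v2, v3, v4} \<inter> P = {}"
    "pverts G = {v0, v1, v2, v3, v4} \<union> P"
    "parcs G = symcl ({(v0, v1), (v1, v2), (v2, v3), (v3, v4), (v4, v0)} \<union> {v0} \<times> P)"
  shows small_or_listed
proof -
  have fin: "finite P" "finite {v0, v1, v2, v3, v4}"
    using pair_finite_verts by (simp_all add: assms(3))
  have "graph_iso G (cycle_pendants [card P, 0, 0, 0, 0])"
    by (rule graph_iso_pentagon_pendants[OF pair_wf_digraph fin(1) assms])
  moreover have "card (pverts G) = card {v0, v1, v2, v3, v4} + card P"
    unfolding assms(3) using fin assms(2) by (intro card_Un_disjoint) auto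
  moreover have "card {v0, v1, v2, v3, v4} = 5" using assms(1) by simp
  ultimately show ?thesis unfolding small_or_listed_def Let_def by simp
qed

lemma listed_triangle_ext:
  assumes "distinct [v0, v1, v2]" "d \<in> M" "T \<noteq> {}" "M \<inter> T = {}" "{v0, v1, v2} \<inter> (M \<union> T) = {}"
    "pverts G = {v0, v1, v2} \<union> M \<union> T"
    "parcs G = symcl ({(v0, v1), (v1, v2), (v2, v0)} \<union> {v0} \<times> M \<union> {d} \<times> T)"
  shows small_or_listed
proof -
  have fin: "finite M" "finite T" "finite {v0, v1, v2}"
    using pair_finite_verts by (simp_all add: assms(6))
  have c: "card M \<ge> 1" "card T \<ge> 1"
    using assms(2,3) fin by (auto simp: Suc_le_eq card_gt_0_iff)
  have "graph_iso G (triangle_pendants_ext (card T) (card M))"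
    unfolding graph_iso_triangle_pendants_ext_iff[OF pair_wf_digraph c(1)]
    by (rule exI[of _ v0], rule exI[of _ v1], rule exI[of _ v2], rule exI[of _ d],
        rule exI[of _ M], rule exI[of _ T]) (intro conjI refl fin assms)
  moreover have "card (pverts G) = card {v0, v1, v2} + card M + card T"
  proof -
    have "({v0, v1, v2} \<union> M) \<inter> T = {}" "{v0, v1, v2} \<inter> M = {}"
      using assms(4,5) by blast+
    then show ?thesis
      unfolding assms(6) using fin by (simp only: card_Un_disjoint finite_UnI)
  qed
  moreover have "card {v0, v1, v2} = 3" using assms(1) by simp
  ultimately have "card M + card T = card (pverts G) - 3 \<and>
      graph_iso G (triangle_pendants_ext (card T) (card M))"
    by simp
  then show ?thesis using c unfolding small_or_listed_def Let_def by blast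
qed

section \<open>Vertices of eccentricity at least 3\<close>

lemma not_centralI:
  assumes "v \<in> pverts G" "v \<noteq> u" "\<not> adj u v" "\<And>w. adj u w \<Longrightarrow> \<not> adj w v"
  shows "\<not> central u"
  using assms unfolding central_def by blast

text \<open>All walks of length 2 from the leaf \<open>w\<close> pass through \<open>u\<close>; if
  they reached everything, \<open>u\<close> would be universal.\<close>

lemma pendant_not_central:
  assumes "\<And>u. u \<in> pverts G \<Longrightarrow> \<not> universal u" "adj w u" "\<And>v. adj w v \<Longrightarrow> v = u"
  shows "\<not> central w"
proof
  assume "central w"
  have "v = u \<or> adj u v" if "v \<in> pverts G" for v
  proof -
    have "v = w \<or> adj w v \<or> (\<exists>z. adj w z \<and> adj z v)"
      using \<open>central w\<close> that unfolding central_def by (rule bspec)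
    then show ?thesis
      using adj_sym[OF assms(2)] assms(3) by metis
  qed
  then have "universal u" by (simp add: universal_def)
  then show False using assms(1)[OF in_arcsD2[OF assms(2)]] by simp
qed

text \<open>The leaves are non-central by \<open>pendant_not_central\<close>. So are their
  neighbours: each opposite leaf is reached only through its own neighbour, which is neither
  \<open>u1\<close> nor adjacent to it, and symmetrically for \<open>u2\<close>. Both pendent edges
  are therefore far.\<close>

lemma card_far_arcs_pendants:
  assumes nu: "\<And>u. u \<in> pverts G \<Longrightarrow> \<not> universal u"
    and b1: "adj b1 u1" "\<And>v. adj b1 v \<Longrightarrow> v = u1"
    and b2: "adj b2 u2" "\<And>v. adj b2 v \<Longrightarrow> v = u2"
    and u: "u1 \<noteq> u2" "\<not> adj u1 u2"
  shows "card far_arcs \<ge> 4"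
proof -
  have u': "\<not> adj u2 u1" using u(2) adj_sym[of u2 u1] by auto
  have "\<not> central b1" "\<not> central b2"
    using pendant_not_central[OF nu b1] pendant_not_central[OF nu b2] by auto
  moreover have "\<not> central u1"
  proof (rule not_centralI[of b2])
    show "b2 \<in> pverts G" using b2(1) by (rule in_arcsD1)
    show "b2 \<noteq> u1" using b2(1) u(2) by blast
    show "\<not> adj u1 b2" using b2(2)[of u1] u(1) adj_sym[of u1 b2] by auto
    show "\<not> adj w b2" if "adj u1 w" for w using that b2(2)[of w] u(2) adj_sym[of w b2] by auto
  qed
  moreover have "\<not> central u2"
  proof (rule not_centralI[of b1])
    show "b1 \<in> pverts G" using b1(1) by (rule in_arcsD1)
    show "b1 \<noteq> u2" using b1(1) u' by blast
    show "\<not> adj u2 b1" using b1(2)[of u2] u(1) adj_sym[of u2 b1] by auto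
    show "\<not> adj w b1" if "adj u2 w" for w using that b1(2)[of w] u' adj_sym[of w b1] by auto
  qed
  ultimately have "(b1, u1) \<in> far_arcs" "(b2, u2) \<in> far_arcs"
    using b1(1) b2(1) by (simp_all add: far_arcs_def)
  moreover have "{b1, u1} \<noteq> {b2, u2}"
    using u b1(1) b2(1) by (auto simp: doubleton_eq_iff)
  ultimately show ?thesis by (rule card_far_arcs_ge_4)
qed

end

section \<open>Trees of depth two with one extra edge\<close>

locale two_level_graph = connected_pair_graph +
  fixes c :: 'a and A B :: "'a set" and p :: "'a \<Rightarrow> 'a" and x y :: 'a
  assumes verts: "pverts G = insert c (A \<union> B)" and c_notin: "c \<notin> A" "c \<notin> B"
    and disj: "A \<inter> B = {}" and parent: "\<And>b. b \<in> B \<Longrightarrow> p b \<in> A"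
    and arcs: "parcs G = symcl ({c} \<times> A \<union> (\<lambda>b. (p b, b)) ` B \<union> {(x, y)})"
    and not_universal: "\<And>u. u \<in> pverts G \<Longrightarrow> \<not> universal u"
    and card_arcs: "card (parcs G) \<le> 2 * card (pverts G)"
begin

lemma adj_iff:
  "adj u v \<longleftrightarrow> u = c \<and> v \<in> A \<or> v = c \<and> u \<in> A \<or> v \<in> B \<and> u = p v \<or> u \<in> B \<and> v = p u \<or>
     u = x \<and> v = y \<or> u = y \<and> v = x"
  unfolding arcs symcl_iff by (simp add: image_iff) metis

lemma small:
  assumes "card far_arcs \<ge> 4"
  shows small_or_listed
proof -
  have "card (pverts G) > 0" using pair_finite_verts by (simp add: card_gt_0_iff verts)
  then have "ABC3 G < (real (card (pverts G)) - 1) * sqrt (1 / 2) + abc_f 3 3"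
    using assms card_arcs by (intro ABC3_less[OF not_universal]) auto
  then show ?thesis by (simp add: small_or_listed_def Let_def)
qed

lemma B_nonempty: "B \<noteq> {}"
proof
  assume "B = {}"
  then have "universal c" by (simp add: universal_def verts adj_iff)
  then show False using not_universal by (simp add: verts)
qed

text \<open>Vertices of \<open>B\<close> off the extra edge are leaves, and two vertices of
  \<open>A\<close> can be adjacent only through the extra edge, so
  \<open>card_far_arcs_pendants\<close> applies.\<close>

lemma small_pendants:
  assumes "b1 \<in> B" "b1 \<notin> {x, y}" "b2 \<in> B" "b2 \<notin> {x, y}" "p b1 \<noteq> p b2" "{p b1, p b2} \<noteq> {x, y}"
  shows small_or_listed
proof (rule small, rule card_far_arcs_pendants[OF not_universal])
  note * = assms c_notin disj parent[OF assms(1)] parent[OF assms(3)]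
  have ne: "b1 \<noteq> c" "b2 \<noteq> c" "b1 \<notin> A" "b2 \<notin> A" "p b1 \<noteq> c" "p b2 \<noteq> c" "p b1 \<notin> B" "p b2 \<notin> B"
    using * by auto
  have pe: "b1 \<noteq> p v" "b2 \<noteq> p v" if "v \<in> B" for v
    using parent[OF that] ne by auto
  show "adj b1 (p b1)" "adj b2 (p b2)" using * by (simp_all add: adj_iff)
  show "v = p b1" if "adj b1 v" for v
    using that ne pe assms(2) by (simp add: adj_iff) metis
  show "v = p b2" if "adj b2 v" for v
    using that ne pe assms(4) by (simp add: adj_iff) metis
  show "p b1 \<noteq> p b2" by fact
  show "\<not> adj (p b1) (p b2)"
    using ne assms(6) by (simp add: adj_iff doubleton_eq_iff)
qed

text \<open>The cycle is the triangle \<open>c x y\<close>. If the second level hangs from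
  \<open>x\<close> and \<open>y\<close> only, all leaves sit on the triangle; if it hangs from one
  other vertex, that vertex is the \<open>d\<close> of the extended triangle. Any other distribution
  has two pendent edges at non-adjacent parents.\<close>

lemma extra_edge_AA:
  assumes xy: "x \<in> A" "y \<in> A" "x \<noteq> y"
  shows small_or_listed
proof -
  have ne: "x \<noteq> c" "y \<noteq> c" "x \<notin> B" "y \<notin> B" using xy c_notin disj by auto
  consider (1) "p ` B \<subseteq> {x, y}" | (2) u where "u \<in> p ` B" "u \<notin> {x, y}" "p ` B \<subseteq> {u}"
    | (3) b1 b2 where "b1 \<in> B" "b2 \<in> B" "p b1 \<notin> {x, y}" "p b1 \<noteq> p b2"
  proof (cases "p ` B \<subseteq> {x, y}")
    case False
    then obtain b1 where b1: "b1 \<in> B" "p b1 \<notin> {x, y}" by auto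
    show thesis
    proof (cases "p ` B \<subseteq> {p b1}")
      case True
      then show thesis using b1 by (intro that(2)[of "p b1"]) auto
    next
      case False
      then obtain b2 where "b2 \<in> B" "p b2 \<noteq> p b1" by auto
      then show thesis using b1 by (intro that(3)[of b1 b2]) auto
    qed
  qed (rule that(1))
  then show ?thesis
  proof cases
    case 1
    then have pB: "p b = x \<or> p b = y" if "b \<in> B" for b using that by auto
    show ?thesis
    proof (rule listed_triangle[of c x y "A - {x, y}" "{b \<in> B. p b = x}" "{b \<in> B. p b = y}"])
      show "distinct [c, x, y]" using ne xy by auto
      show "{c, x, y} \<inter> (A - {x, y} \<union> {b \<in> B. p b = x} \<union> {b \<in> B. p b = y}) = {}"
        "(A - {x, y}) \<inter> {b \<in> B. p b = x} = {}" "(A - {x, y}) \<inter> {b \<in> B. p b = y} = {}"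
        "{b \<in> B. p b = x} \<inter> {b \<in> B. p b = y} = {}"
        using ne xy c_notin disj by auto
      show "pverts G = {c, x, y} \<union> (A - {x, y}) \<union> {b \<in> B. p b = x} \<union> {b \<in> B. p b = y}"
        unfolding verts using xy pB by auto
      show "parcs G = symcl ({(c, x), (x, y), (y, c)} \<union> {c} \<times> (A - {x, y}) \<union>
          {x} \<times> {b \<in> B. p b = x} \<union> {y} \<times> {b \<in> B. p b = y})"
        unfolding arcs by (rule symcl_eqI) (use xy pB in \<open>simp add: image_iff; metis\<close>)+
    qed
  next
    case 2
    then have pB: "p b = u" if "b \<in> B" for b using that by auto
    have u: "u \<in> A" using 2 parent by auto
    show ?thesis
    proof (rule listed_triangle_ext[of c x y u "A - {x, y}" B])
      show "distinct [c, x, y]" using ne xy by auto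
      show "u \<in> A - {x, y}" using u 2 by simp
      show "B \<noteq> {}" by (rule B_nonempty)
      show "{c, x, y} \<inter> (A - {x, y} \<union> B) = {}" "(A - {x, y}) \<inter> B = {}"
        using ne c_notin disj by auto
      show "pverts G = {c, x, y} \<union> (A - {x, y}) \<union> B"
        unfolding verts using xy by auto
      show "parcs G = symcl ({(c, x), (x, y), (y, c)} \<union> {c} \<times> (A - {x, y}) \<union> {u} \<times> B)"
        unfolding arcs by (rule symcl_eqI) (use xy pB in \<open>simp add: image_iff; metis\<close>)+
    qed
  next
    case 3
    then show ?thesis using ne by (intro small_pendants[of b1 b2]) auto
  qed
qed

text \<open>The cycle is the quadrangle \<open>c a x y\<close> with \<open>a = p x\<close>.
  First-level leaves hang from \<open>c\<close>, so a listed graph appears when the other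
  second-level vertices hang all from \<open>a\<close> or all from \<open>y\<close>, the cycle
  neighbours of \<open>c\<close>.\<close>

lemma extra_edge_BA:
  assumes xy: "x \<in> B" "y \<in> A" "p x \<noteq> y"
  shows small_or_listed
proof -
  define a where "a = p x"
  have a: "a \<in> A" "a \<noteq> y" using xy parent by (auto simp: a_def)
  have ne: "x \<noteq> c" "y \<noteq> c" "x \<notin> A" "y \<notin> B" "a \<notin> B" "a \<noteq> c" "a \<noteq> x" "x \<noteq> y"
    using xy a c_notin disj by auto
  \<comment> \<open>A leaf whose parent is off the cycle suffices alone; otherwise leaves with
    different parents suffice as a pair. The two alternatives may overlap.\<close>
  consider (1) "p ` (B - {x}) \<subseteq> {a}" | (2) "p ` (B - {x}) \<subseteq> {y}"
    | (3) w where "w \<in> B" "w \<noteq> x" "p w \<noteq> a" "p w \<noteq> y"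
    | (4) b1 b2 where "b1 \<in> B - {x}" "b2 \<in> B - {x}" "p b1 \<noteq> p b2"
  proof (cases "p ` (B - {x}) \<subseteq> {a} \<or> p ` (B - {x}) \<subseteq> {y}")
    case False
    then obtain b1 b2 where b: "b1 \<in> B - {x}" "p b1 \<noteq> a" "b2 \<in> B - {x}" "p b2 \<noteq> y" by auto
    show thesis
    proof (cases "p b1 = p b2")
      case True
      then show thesis using b by (intro that(3)[of b1]) auto
    next
      case False
      then show thesis using b by (intro that(4)[of b1 b2]) auto
    qed
  qed (use that(1,2) in auto)
  then show ?thesis
  proof cases
    case 1
    then have pB: "p b = a" if "b \<in> B" for b using that by (auto simp: a_def)
    show ?thesis
    proof (rule listed_quadrangle[of a c y x "B - {x}" "A - {a, y}"])
      show "distinct [a, c, y, x]" using ne a by auto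
      show "{a, c, y, x} \<inter> (B - {x} \<union> (A - {a, y})) = {}" "(B - {x}) \<inter> (A - {a, y}) = {}"
        using ne c_notin disj by auto
      show "pverts G = {a, c, y, x} \<union> (B - {x}) \<union> (A - {a, y})"
        unfolding verts using xy a by auto
      show "parcs G = symcl ({(a, c), (c, y), (y, x), (x, a)} \<union> {a} \<times> (B - {x}) \<union> {c} \<times> (A - {a, y}))"
        unfolding arcs by (rule symcl_eqI) (use xy a pB in \<open>simp add: image_iff; metis\<close>)+
    qed
  next
    case 2
    then have pB: "p b = (if b = x then a else y)" if "b \<in> B" for b
      using that by (auto simp: a_def)
    show ?thesis
    proof (rule listed_quadrangle[of y c a x "B - {x}" "A - {a, y}"])
      show "distinct [y, c, a, x]" using ne a by auto
      show "{y, c, a, x} \<inter> (B - {x} \<union> (A - {a, y})) = {}" "(B - {x}) \<inter> (A - {a, y}) = {}"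
        using ne c_notin disj by auto
      show "pverts G = {y, c, a, x} \<union> (B - {x}) \<union> (A - {a, y})"
        unfolding verts using xy a by auto
      show "parcs G = symcl ({(y, c), (c, a), (a, x), (x, y)} \<union> {y} \<times> (B - {x}) \<union> {c} \<times> (A - {a, y}))"
        unfolding arcs by (rule symcl_eqI) (use xy a pB in \<open>simp add: image_iff; metis\<close>)+
    qed
  next
    case 3
    then have w: "w \<noteq> c" "w \<notin> A" "w \<noteq> y" "w \<noteq> a" "p w \<in> A" "p w \<noteq> c" "p w \<notin> B" "p w \<noteq> x"
      using xy a ne c_notin disj parent[OF 3(1)] by auto
    have nw: "\<not> adj a (p w)" "\<not> adj y (p w)" "\<not> adj x (p w)"
      using 3 w ne a by (auto simp: adj_iff a_def[symmetric])
    have adjw: "z = p w" if "adj z w" for z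
      using that 3 w by (auto simp: adj_iff dest: parent)
    \<comment> \<open>Every route from \<open>w\<close> to \<open>a\<close> or \<open>y\<close>
      passes through \<open>p w\<close> and \<open>c\<close>, and \<open>p w\<close> is three steps
      from \<open>x\<close>; hence both cycle edges at \<open>x\<close> are far.\<close>
    have "\<not> central a" "\<not> central y"
      by (rule not_centralI[of w]; use 3 w nw adjw verts in blast)+
    moreover have "\<not> central x"
    proof (rule not_centralI[of "p w"])
      show "\<not> adj z (p w)" if "adj x z" for z
        using that ne nw xy by (auto simp: adj_iff a_def dest: parent)
    qed (use w nw verts in auto)
    moreover have "adj a x" "adj y x" using xy by (auto simp: adj_iff a_def)
    ultimately have "(a, x) \<in> far_arcs" "(y, x) \<in> far_arcs" by (auto simp: far_arcs_def)
    then show ?thesis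
      using a ne by (intro small card_far_arcs_ge_4[of a x y x]) (auto simp: doubleton_eq_iff)
  next
    case 4
    then have "p b1 \<noteq> x" "p b2 \<noteq> x" using ne parent[of b1] parent[of b2] by auto
    then show ?thesis
      using 4 ne by (intro small_pendants[of b1 b2]) (auto simp: doubleton_eq_iff)
  qed
qed

text \<open>The cycle is the triangle \<open>a x y\<close> below \<open>c\<close>. If the whole
  second level hangs from \<open>a\<close>, the roles change: \<open>c\<close> becomes a neighbour
  of \<open>a\<close> off the triangle that carries the leaves \<open>A - {a}\<close>. Otherwise
  some \<open>w\<close> with another parent is four steps from \<open>x\<close> and
  \<open>y\<close>, so that \<open>xy\<close> and the edge at \<open>w\<close> are both far.\<close>

lemma extra_edge_BB_triangle:
  assumes xy: "x \<in> B" "y \<in> B" "x \<noteq> y" "p x = p y"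
  shows small_or_listed
proof -
  define a where "a = p x"
  have pxy: "p x = a" "p y = a" using xy by (simp_all add: a_def)
  have a: "a \<in> A" using xy parent by (auto simp: a_def)
  have ne: "x \<noteq> c" "y \<noteq> c" "x \<notin> A" "y \<notin> A" "a \<notin> B" "a \<noteq> c" "a \<noteq> x" "a \<noteq> y"
    using xy a c_notin disj by auto
  show ?thesis
  proof (cases "p ` B \<subseteq> {a}")
    case True
    then have pB: "p b = a" if "b \<in> B" for b using that by auto
    show ?thesis
    proof (rule listed_triangle_ext[of a x y c "insert c (B - {x, y})" "A - {a}"])
      show "distinct [a, x, y]" using ne xy by auto
      \<comment> \<open>If \<open>a\<close> were the only first-level vertex, it would be adjacent
        to everything else.\<close>
      show "A - {a} \<noteq> {}"
      proof
        assume "A - {a} = {}"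
        then have "A = {a}" using a by auto
        then have "universal a" using pB by (simp add: universal_def verts adj_iff)
        then show False using not_universal a by (simp add: verts)
      qed
      show "insert c (B - {x, y}) \<inter> (A - {a}) = {}" "{a, x, y} \<inter> (insert c (B - {x, y}) \<union> (A - {a})) = {}"
        using ne c_notin disj by auto
      show "pverts G = {a, x, y} \<union> insert c (B - {x, y}) \<union> (A - {a})"
        unfolding verts using xy a by auto
      show "parcs G = symcl ({(a, x), (x, y), (y, a)} \<union> {a} \<times> insert c (B - {x, y}) \<union> {c} \<times> (A - {a}))"
        unfolding arcs by (rule symcl_eqI) (use xy a pB in \<open>simp add: image_iff; metis\<close>)+
    qed simp
  next
    case False
    then obtain w where w: "w \<in> B" "p w \<noteq> a" by auto
    then have ne_w: "w \<noteq> c" "w \<notin> A" "w \<noteq> x" "w \<noteq> y" "w \<noteq> a" "p w \<in> A" "p w \<noteq> c" "p w \<notin> B"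
        "p w \<noteq> x" "p w \<noteq> y"
      using xy a ne c_notin disj parent[OF w(1)] pxy by auto
    have pv: "v \<noteq> p b" if "v \<in> B" "b \<in> B" for v b
      using parent[OF that(2)] that disj by auto
    have adj_x: "adj x v \<longleftrightarrow> v = a \<or> v = y" for v
      using ne xy pxy pv by (simp add: adj_iff) metis
    have adj_y: "adj y v \<longleftrightarrow> v = a \<or> v = x" for v
      using ne xy pxy pv by (simp add: adj_iff) metis
    have adj_w: "adj w v \<longleftrightarrow> v = p w" for v
      using ne_w w pv by (simp add: adj_iff) metis
    have nadj: "\<not> adj a w" "\<not> adj (p w) x" "\<not> adj (p w) y" "\<not> adj (p w) a"
      using w ne ne_w a pxy by (auto simp: adj_iff)
    have "\<not> central x"
      by (rule not_centralI[of w]) (use w ne_w nadj adj_x adj_y adj_w adj_sym[of y w] verts in auto)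
    moreover have "\<not> central y"
      by (rule not_centralI[of w]) (use w ne_w nadj adj_x adj_y adj_w adj_sym[of x w] verts in auto)
    moreover have "\<not> central w"
      by (rule pendant_not_central[OF not_universal, of w "p w"]) (simp_all add: adj_w)
    moreover have "\<not> central (p w)"
    proof (rule not_centralI[of x])
      show "\<not> adj z x" if "adj (p w) z" for z
        using that nadj adj_x[of z] adj_sym[of z x] by auto
    qed (use xy ne_w nadj verts in auto)
    ultimately have "(x, y) \<in> far_arcs" "(w, p w) \<in> far_arcs"
      using adj_x adj_w by (auto simp: far_arcs_def)
    then show ?thesis
      using ne_w by (intro small card_far_arcs_ge_4[of x y w "p w"]) (auto simp: doubleton_eq_iff)
  qed
qed

text \<open>The cycle is the pentagon \<open>c a x y b\<close>. A listed graph has its leaves at a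
  single cycle vertex: at \<open>c\<close> when \<open>B = {x, y}\<close>, at \<open>a\<close> or
  \<open>b\<close> when \<open>A = {a, b}\<close>. All other distributions give two far edges,
  either pendent ones or consecutive ones on the cycle.\<close>

lemma extra_edge_BB_pentagon:
  assumes xy: "x \<in> B" "y \<in> B" "p x \<noteq> p y"
  shows small_or_listed
proof -
  define a b where "a = p x" and "b = p y"
  have pxy: "p x = a" "p y = b" by (simp_all add: a_def b_def)
  have ab: "a \<in> A" "b \<in> A" "a \<noteq> b" using xy parent by (auto simp: a_def b_def)
  have ne: "x \<noteq> c" "y \<noteq> c" "x \<notin> A" "y \<notin> A" "a \<notin> B" "a \<noteq> c" "b \<notin> B" "b \<noteq> c" "x \<noteq> y"
     "a \<noteq> x" "a \<noteq> y" "b \<noteq> x" "b \<noteq> y"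
    using xy ab c_notin disj by auto
  have pv: "v \<noteq> p b" if "v \<in> B" "b \<in> B" for v b
    using parent[OF that(2)] that disj by auto
  have adj_x: "adj x v \<longleftrightarrow> v = a \<or> v = y" for v
    using ne xy pxy pv by (simp add: adj_iff) metis
  have adj_y: "adj y v \<longleftrightarrow> v = b \<or> v = x" for v
    using ne xy pxy pv by (simp add: adj_iff) metis
  have adj_w: "adj w v \<longleftrightarrow> v = p w" if "w \<in> B - {x, y}" for w v
    using that pv c_notin disj by (simp add: adj_iff) (metis disjoint_iff)
  have adj_AA: "\<not> adj u v" if "u \<in> A" "v \<in> A" for u v
    using that ne c_notin disj by (auto simp: adj_iff)
  have adj_A: "adj u x \<longleftrightarrow> u = a" "adj u y \<longleftrightarrow> u = b" if "u \<in> A" for u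
    using adj_x[of u] adj_y[of u] adj_sym[of u x] adj_sym[of x u] adj_sym[of u y] adj_sym[of y u] that ne by auto
  have inV: "v \<in> pverts G" if "v \<in> A \<union> B" for v using that by (auto simp: verts)
  have arc: "adj a x" "adj b y" "adj x y"
    using adj_A ab adj_x by auto
  \<comment> \<open>Each of the next five facts names a witness at distance at least 3: a
    first-level vertex off the cycle, or a leaf \<open>w\<close> on a parent that is too far
    away.\<close>
  have far_x: "\<not> central x" if "u \<in> A" "u \<noteq> a" "u \<noteq> b" for u
  proof (rule not_centralI[of u])
    show "\<not> adj z u" if "adj x z" for z
      using that adj_x[of z] adj_y[of u] adj_AA[OF ab(1) \<open>u \<in> A\<close>] \<open>u \<in> A\<close> \<open>u \<noteq> b\<close> ne by auto
  qed (use that ne adj_x[of u] inV in auto)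
  have far_y: "\<not> central y" if "u \<in> A" "u \<noteq> a" "u \<noteq> b" for u
  proof (rule not_centralI[of u])
    show "\<not> adj z u" if "adj y z" for z
      using that adj_y[of z] adj_x[of u] adj_AA[OF ab(2) \<open>u \<in> A\<close>] \<open>u \<in> A\<close> \<open>u \<noteq> a\<close> ne by auto
  qed (use that ne adj_y[of u] inV in auto)
  have far_A: "\<not> central u" if "u \<in> A" "w \<in> B - {x, y}" "p w \<noteq> u" for u w
  proof (rule not_centralI[of w])
    show "\<not> adj z w" if "adj u z" for z
      using that adj_w[OF \<open>w \<in> B - {x, y}\<close>, of z] adj_sym[of z w] adj_AA[OF \<open>u \<in> A\<close> parent[of w]]
        \<open>w \<in> B - {x, y}\<close> by auto
    show "\<not> adj u w" using adj_w[OF that(2), of u] adj_sym[of u w] that(3) by auto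
  qed (use that inV disj in auto)
  have far_y': "\<not> central y" if "w \<in> B - {x, y}" "p w = a" for w
  proof (rule not_centralI[of w])
    show "\<not> adj z w" if "adj y z" for z
      using that adj_w[OF \<open>w \<in> B - {x, y}\<close>, of z] adj_sym[of z w] adj_y[of z] \<open>p w = a\<close> ab ne by auto
  qed (use that adj_y[of w] ne ab inV in auto)
  have far_x': "\<not> central x" if "w \<in> B - {x, y}" "p w = b" for w
  proof (rule not_centralI[of w])
    show "\<not> adj z w" if "adj x z" for z
      using that adj_w[OF \<open>w \<in> B - {x, y}\<close>, of z] adj_sym[of z w] adj_x[of z] \<open>p w = b\<close> ab ne by auto
  qed (use that adj_x[of w] ne ab inV in auto)
  show ?thesis
  proof (cases "B = {x, y}")
    case True
    show ?thesis
    proof (rule listed_pentagon[of c a x y b "A - {a, b}"])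
      show "distinct [c, a, x, y, b]" using ne ab by auto
      show "{c, a, x, y, b} \<inter> (A - {a, b}) = {}" using ne c_notin by auto
      show "pverts G = {c, a, x, y, b} \<union> (A - {a, b})" unfolding verts True using ab by auto
      show "parcs G = symcl ({(c, a), (a, x), (x, y), (y, b), (b, c)} \<union> {c} \<times> (A - {a, b}))"
        unfolding arcs True by (rule symcl_eqI) (use ab pxy in \<open>simp add: image_iff; metis\<close>)+
    qed
  next
    case False
    then obtain w where w: "w \<in> B - {x, y}" using xy by auto
    show ?thesis
    proof (cases "p ` (B - {x, y}) \<subseteq> {p w}")
      case False
      then obtain w' where w': "w' \<in> B - {x, y}" "p w' \<noteq> p w" by auto
      have "{p w, p w'} \<noteq> {x, y}" using w w' parent[of w] ne by (auto simp: doubleton_eq_iff)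
      then show ?thesis using w w' by (intro small_pendants[of w w']) auto
    next
      case True
      then have pB: "p v = p w" if "v \<in> B" "v \<noteq> x" "v \<noteq> y" for v using that by auto
      \<comment> \<open>All further leaves now hang from \<open>p w\<close>. A third vertex
        \<open>u\<close> of \<open>A\<close> makes \<open>x\<close> and \<open>y\<close>
        non-central; in the last alternative \<open>p w\<close> itself plays that role.\<close>
      consider (1) "p w = a" "A = {a, b}" | (2) "p w = b" "A = {a, b}"
        | (3) u where "p w = a" "u \<in> A" "u \<noteq> a" "u \<noteq> b"
        | (4) u where "p w = b" "u \<in> A" "u \<noteq> a" "u \<noteq> b"
        | (5) "p w \<noteq> a" "p w \<noteq> b"
        using ab by fast
      then show ?thesis
      proof cases
        case 1
        show ?thesis
        \<comment> \<open>The enumeration of the pentagon starts at \<open>a\<close>, where the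
          leaves now sit; \<open>c\<close> is an ordinary cycle vertex.\<close>
        proof (rule listed_pentagon[of a x y b c "B - {x, y}"])
          show "distinct [a, x, y, b, c]" using ne ab by auto
          show "{a, x, y, b, c} \<inter> (B - {x, y}) = {}" using ne c_notin by auto
          show "pverts G = {a, x, y, b, c} \<union> (B - {x, y})" unfolding verts 1(2) using xy by auto
          show "parcs G = symcl ({(a, x), (x, y), (y, b), (b, c), (c, a)} \<union> {a} \<times> (B - {x, y}))"
            unfolding arcs 1(2)
            by (rule symcl_eqI) (use xy pxy pB 1(1) in \<open>simp add: image_iff; metis\<close>)+
        qed
      next
        case 2
        show ?thesis
        proof (rule listed_pentagon[of b y x a c "B - {x, y}"])
          show "distinct [b, y, x, a, c]" using ne ab by auto
          show "{b, y, x, a, c} \<inter> (B - {x, y}) = {}" using ne c_notin by auto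
          show "pverts G = {b, y, x, a, c} \<union> (B - {x, y})" unfolding verts 2(2) using xy by auto
          show "parcs G = symcl ({(b, y), (y, x), (x, a), (a, c), (c, b)} \<union> {b} \<times> (B - {x, y}))"
            unfolding arcs 2(2)
            by (rule symcl_eqI) (use xy pxy pB 2(1) in \<open>simp add: image_iff; metis\<close>)+
        qed
      next
        case 3
        have "(b, y) \<in> far_arcs" "(x, y) \<in> far_arcs"
          using far_A[OF ab(2) w] far_y'[OF w] far_x[OF 3(2-4)] 3(1) ab arc by (auto simp: far_arcs_def)
        then show ?thesis
          using ne by (intro small card_far_arcs_ge_4[of b y x y]) (auto simp: doubleton_eq_iff)
      next
        case 4
        have "(a, x) \<in> far_arcs" "(x, y) \<in> far_arcs"
          using far_A[OF ab(1) w] far_x'[OF w] far_y[OF 4(2-4)] 4(1) ab arc by (auto simp: far_arcs_def)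
        then show ?thesis
          using ne by (intro small card_far_arcs_ge_4[of a x x y]) (auto simp: doubleton_eq_iff)
      next
        case 5
        have "p w \<in> A" using w parent by auto
        then have "(a, x) \<in> far_arcs" "(x, y) \<in> far_arcs"
          using far_A[OF ab(1) w] far_x[of "p w"] far_y[of "p w"] 5 arc by (auto simp: far_arcs_def)
        then show ?thesis
          using ne by (intro small card_far_arcs_ge_4[of a x x y]) (auto simp: doubleton_eq_iff)
      qed
    qed
  qed
qed

end

section \<open>Reduction to a tree with at most one extra edge\<close>

context at_most_unicyclic_graph
begin

text \<open>Centrality of the root bounds the levels by 2, so the tree consists of the arcs from
  \<open>c\<close> to \<open>A\<close> and the parent arcs of \<open>B\<close>. A bare tree has too
  few edges; otherwise the levels of the ends of the extra edge decide the case.\<close>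

lemma small_or_listed_central:
  assumes nu: "\<And>u. u \<in> pverts G \<Longrightarrow> \<not> universal u" and c: "c \<in> pverts G" "central c"
  shows small_or_listed
proof -
  obtain p where p: "bfs_parent c p" using ex_bfs_parent[OF c(1)] by blast
  define A B where "A = {v. adj c v}" and "B = pverts G - insert c A"
  have AV: "A \<subseteq> pverts G" by (auto simp: A_def dest: in_arcsD2)
  have V: "pverts G = insert c (A \<union> B)" using c(1) AV by (auto simp: B_def)
  have cA: "c \<notin> A" by (auto simp: A_def dest: no_loops')
  have par: "adj v (p v)" "level c v = Suc (level c (p v))" if "v \<in> pverts G" "v \<noteq> c" for v
    using p that by (auto simp: bfs_parent_def)
  have level_p: "(c, p v) \<in> parcs G ^^ level c (p v)" if "v \<in> pverts G" "v \<noteq> c" for v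
    using par(1)[OF that] by (intro relpow_level c(1)) (rule in_arcsD2)
  have pA: "p v = c" if "v \<in> A" for v
  proof -
    have v: "v \<in> pverts G" "v \<noteq> c" using that AV cA by auto
    have "level c v \<le> 1" using that by (intro level_le) (simp add: A_def)
    then have "level c (p v) = 0" using par(2)[OF v] by simp
    then show ?thesis using level_p[OF v] by simp
  qed
  have pB: "p v \<in> A" if "v \<in> B" for v
  proof -
    have v: "v \<in> pverts G" "v \<noteq> c" "\<not> adj c v" using that by (auto simp: B_def A_def)
    then obtain w where "adj c w" "adj w v" using c(2) unfolding central_def by metis
    then have "(c, v) \<in> parcs G ^^ Suc (Suc 0)" by auto
    then have "level c v \<le> Suc (Suc 0)" by (rule level_le)
    then have "level c (p v) = 0 \<or> level c (p v) = 1" using par(2)[OF v(1,2)] by linarith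
    moreover have "p v \<noteq> c" using par(1)[OF v(1,2)] v(3) adj_sym[of v c] by auto
    ultimately show ?thesis using level_p[OF v(1,2)] by (auto simp: A_def)
  qed
  have n: "card (pverts G) \<ge> 1" using c(1) pair_finite_verts card_gt_0_iff[of "pverts G"] by fastforce
  have n': "card (parcs G) \<le> 2 * card (pverts G)" using c(1) by (intro card_arcs_le) auto
  have tree: "(u, v) \<in> tree_arcs c p \<longleftrightarrow>
      u \<in> pverts G \<and> u \<noteq> c \<and> v = p u \<or> v \<in> pverts G \<and> v \<noteq> c \<and> u = p v" for u v
    unfolding tree_arcs_def symcl_iff by auto
  show ?thesis
    using p
  proof (cases rule: arcs_cases)
    case tree
    then have "card (parcs G) \<le> 2 * (card (pverts G) - 1)"
      using card_tree_arcs_le[OF c(1), of p] by simp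
    then have "ABC3 G < (real (card (pverts G)) - 1) * sqrt (1 / 2) + abc_f 3 3"
      using n by (intro ABC3_less[OF nu]) auto
    then show ?thesis by (simp add: small_or_listed_def Let_def)
  next
    case (extra x y)
    have yx: "(y, x) \<notin> tree_arcs c p" using extra(2) tree_arcs_sym[of y x c p] by auto
    have xyV: "x \<in> pverts G" "y \<in> pverts G" "x \<noteq> y"
      using extra(1) by (auto dest: in_arcsD1 in_arcsD2 no_loops')
    \<comment> \<open>Every edge at \<open>c\<close> belongs to the tree, because the parent of a
      neighbour of \<open>c\<close> is \<open>c\<close>.\<close>
    have xy_c: "x \<noteq> c" "y \<noteq> c"
      using extra(1,2) xyV pA[of x] pA[of y] adj_sym[OF extra(1)] cA by (auto simp: tree A_def)
    have arcs: "parcs G = symcl ({c} \<times> A \<union> (\<lambda>b. (p b, b)) ` B \<union> {(x', y')})"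
      if "{x', y'} = {x, y}" for x' y'
    proof -
      have "tree_arcs c p = symcl ({c} \<times> A \<union> (\<lambda>b. (p b, b)) ` B)"
        unfolding tree_arcs_def V using pA cA
        by (intro symcl_eqI) (auto simp: B_def)
      then show ?thesis
        using extra(3) that by (auto simp: symcl_Un symcl_iff doubleton_eq_iff)
    qed
    \<comment> \<open>Available for both orders of the pair, so that an extra edge from
      \<open>A\<close> to \<open>B\<close> can be reversed for \<open>extra_edge_BA\<close>.\<close>
    have loc: "two_level_graph G c A B p x' y'" if "{x', y'} = {x, y}" for x' y'
    proof (intro two_level_graph.intro connected_pair_graph_axioms two_level_graph_axioms.intro)
      show "c \<notin> B" "A \<inter> B = {}" by (auto simp: B_def)
    qed (fact V cA pB arcs[OF that] nu n')+
    have pxy: "p x \<noteq> y" "p y \<noteq> x" using extra(2) xyV xy_c by (auto simp: tree)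
    consider "x \<in> A" "y \<in> A" | "x \<in> B" "y \<in> A" | "x \<in> A" "y \<in> B" | "x \<in> B" "y \<in> B" "p x = p y"
      | "x \<in> B" "y \<in> B" "p x \<noteq> p y"
      using xyV xy_c unfolding V by auto
    then show ?thesis
    proof cases
      case 1
      then show ?thesis using xyV by (intro two_level_graph.extra_edge_AA[OF loc[of x y]]) auto
    next
      case 2
      then show ?thesis using pxy by (intro two_level_graph.extra_edge_BA[OF loc[of x y]]) auto
    next
      case 3
      then show ?thesis using pxy by (intro two_level_graph.extra_edge_BA[OF loc[of y x]]) auto
    next
      case 4
      then show ?thesis using xyV by (intro two_level_graph.extra_edge_BB_triangle[OF loc[of x y]]) auto
    next
      case 5
      then show ?thesis by (intro two_level_graph.extra_edge_BB_pentagon[OF loc[of x y]]) auto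
    qed
  qed
qed

text \<open>The tree is a star at \<open>c\<close>. An extra edge closes a triangle with all leaves
  at \<open>c\<close>, an excluded graph. For the bare star \<open>ABC3_le\<close> does not apply,
  and the estimate is redone for edges with an end of eccentricity at most 1.\<close>

lemma small_or_listed_universal:
  assumes c: "c \<in> pverts G" "universal c"
  shows small_or_listed
proof -
  obtain p where p: "bfs_parent c p" using ex_bfs_parent[OF c(1)] by blast
  have adj_c: "adj c v" if "v \<in> pverts G" "v \<noteq> c" for v
    using c(2) that by (auto simp: universal_def)
  have pc: "p v = c" if "v \<in> pverts G" "v \<noteq> c" for v
  proof -
    have v: "adj v (p v)" "level c v = Suc (level c (p v))"
      using p that by (auto simp: bfs_parent_def)
    have "level c v \<le> 1" using adj_c[OF that] by (intro level_le) simp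
    then have "level c (p v) = 0" using v(2) by simp
    then show ?thesis using relpow_level[OF c(1) in_arcsD2[OF v(1)]] by simp
  qed
  have tree: "tree_arcs c p = symcl ({c} \<times> (pverts G - {c}))"
    unfolding tree_arcs_def by (rule symcl_eqI) (use pc in auto)
  have n: "card (pverts G) \<ge> 1" using c(1) pair_finite_verts card_gt_0_iff[of "pverts G"] by fastforce
  show ?thesis
    using p
  proof (cases rule: arcs_cases)
    case tree: tree
    have central: "central v" if "v \<in> pverts G" for v
      unfolding central_def
    proof
      fix w assume "w \<in> pverts G"
      then show "w = v \<or> adj v w \<or> (\<exists>z. adj v z \<and> adj z w)"
        using adj_c[of v] adj_c[of w] adj_sym[of c v] that by metis
    qed
    \<comment> \<open>The largest value is \<open>abc_f 1 2 = sqrt (1 / 2)\<close>;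
      \<open>abc_f 1 1\<close> is 0, and so are the values with an argument 0, by division by
      zero.\<close>
    have le: "abc_f x y \<le> sqrt (1 / 2)" if "x = real i" "y = real j" "x \<le> 1" "y \<le> 2" for x y i j
    proof -
      have "i = 0 \<or> i = 1" "j = 0 \<or> j = 1 \<or> j = 2" using that by auto
      then show ?thesis using that by (auto simp: abc_f_def)
    qed
    have "(case e of (u, v) \<Rightarrow> abc_f (ecc G u) (ecc G v)) \<le> sqrt (1 / 2)" if "e \<in> parcs G" for e
    proof -
      obtain u v where e: "e = (u, v)" by (cases e)
      have uv: "u \<in> pverts G" "v \<in> pverts G" using that e by (auto dest: in_arcsD1 in_arcsD2)
      obtain i j where ij: "ecc G u = real i" "ecc G v = real j"
        using ecc_nat[OF uv(1)] ecc_nat[OF uv(2)] by metis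
      have two: "ecc G u \<le> 2" "ecc G v \<le> 2"
        using uv central by (simp_all add: ecc_le_2_iff)
      have "u = c \<or> v = c" using that e \<open>parcs G = _\<close> \<open>tree_arcs c p = _\<close> by (auto simp: symcl_iff)
      then have "ecc G u \<le> 1 \<or> ecc G v \<le> 1"
        using ecc_le_1_iff[OF c(1)] c(2) by auto
      then show ?thesis
        using le[OF ij] le[OF ij(2,1)] two abc_f_commute[of "ecc G u"] by (auto simp: e)
    qed
    then have "(\<Sum>e\<in>parcs G. case e of (u, v) \<Rightarrow> abc_f (ecc G u) (ecc G v)) \<le>
        real (card (parcs G)) * sqrt (1 / 2)"
      by (rule sum_bounded_above)
    then have "2 * ABC3 G \<le> real (card (parcs G)) * sqrt (1 / 2)" by (simp add: ABC3_def)
    also have "card (parcs G) \<le> 2 * (card (pverts G) - 1)"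
      using card_tree_arcs_le[OF c(1), of p] tree by simp
    then have "real (card (parcs G)) * sqrt (1 / 2) \<le> 2 * (real (card (pverts G)) - 1) * sqrt (1 / 2)"
      using n by (intro mult_right_mono) (simp_all add: of_nat_diff[symmetric] del: of_nat_diff)
    finally have "ABC3 G < (real (card (pverts G)) - 1) * sqrt (1 / 2) + abc_f 3 3"
      by (simp add: abc_f_3_3 algebra_simps)
    then show ?thesis by (simp add: small_or_listed_def Let_def)
  next
    case (extra x y)
    have xy: "x \<in> pverts G" "y \<in> pverts G" "x \<noteq> y"
      using extra(1) by (auto dest: in_arcsD1 in_arcsD2 no_loops')
    have xy_c: "x \<noteq> c" "y \<noteq> c"
      using extra(2) xy by (auto simp: tree symcl_iff)
    show ?thesis
    proof (rule listed_triangle[of c x y "pverts G - {c, x, y}" "{}" "{}"])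
      show "distinct [c, x, y]" using xy xy_c by auto
      show "pverts G = {c, x, y} \<union> (pverts G - {c, x, y}) \<union> {} \<union> {}" using xy c(1) by auto
      show "parcs G = symcl ({(c, x), (x, y), (y, c)} \<union> {c} \<times> (pverts G - {c, x, y}) \<union> {x} \<times> {} \<union> {y} \<times> {})"
      proof -
        have "parcs G = symcl ({c} \<times> (pverts G - {c}) \<union> {(x, y)})"
          unfolding extra(3) tree by (auto simp: symcl_Un symcl_iff)
        also have "\<dots> = symcl ({(c, x), (x, y), (y, c)} \<union> {c} \<times> (pverts G - {c, x, y}) \<union> {x} \<times> {} \<union> {y} \<times> {})"
          by (rule symcl_eqI) (use xy xy_c in \<open>simp; metis\<close>)+
        finally show ?thesis .
      qed
    qed auto
  qed
qed

lemma small_or_listed: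
  assumes "card (pverts G) \<ge> 6"
  shows small_or_listed
proof -
  consider (1) c where "c \<in> pverts G" "universal c"
    | (2) c where "c \<in> pverts G" "central c" "\<And>u. u \<in> pverts G \<Longrightarrow> \<not> universal u"
    | (3) "\<And>u. u \<in> pverts G \<Longrightarrow> \<not> universal u" "\<And>u. u \<in> pverts G \<Longrightarrow> \<not> central u"
    by metis
  then show ?thesis
  proof cases
    case 1
    then show ?thesis by (rule small_or_listed_universal)
  next
    case 2
    then show ?thesis by (intro small_or_listed_central)
  next
    case 3
    \<comment> \<open>Either there are at most \<open>n - 1\<close> edges or, as
      \<open>n \<ge> 6\<close>, the number of arcs, all of them far, exceeds 4;
      \<open>ABC3_less\<close> covers both.\<close>
    have "far_arcs = parcs G"
      using 3(2) by (auto simp: far_arcs_def dest: in_arcsD1 in_arcsD2)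
    moreover have "card (parcs G) \<le> 2 * card (pverts G)"
      using assms by (intro card_arcs_le) auto
    ultimately have "ABC3 G < (real (card (pverts G)) - 1) * sqrt (1 / 2) + abc_f 3 3"
      using assms by (intro ABC3_less[OF 3(1)]) auto
    then show ?thesis by (simp add: small_or_listed_def Let_def)
  qed
qed

end

section \<open>The extremal graphs\<close>

context connected_pair_graph
begin

text \<open>A first step to \<open>w\<close> adds one to the radius 2 around
  \<open>w\<close>.\<close>

lemma ecc_eq_3:
  assumes "adj u w" "central w" "\<not> central u"
  shows "ecc G u = 3"
proof (rule antisym)
  have u: "u \<in> pverts G" using assms(1) by (rule in_arcsD1)
  show "ecc G u \<ge> 3" using u assms(3) by (rule ecc_ge_3)
  show "ecc G u \<le> 3"
  proof (rule ecc_le_3I[OF u])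
    fix v assume "v \<in> pverts G"
    then have "v = w \<or> adj w v \<or> (\<exists>z. adj w z \<and> adj z v)"
      using assms(2) unfolding central_def by simp
    then show "v = u \<or> adj u v \<or> (\<exists>w. adj u w \<and> adj w v) \<or> (\<exists>w x. adj u w \<and> adj w x \<and> adj x v)"
      using assms(1) by metis
  qed
qed

text \<open>Reduces the value of the sum to adjacency checks: the central neighbours
  \<open>p'\<close> and \<open>q'\<close> certify that the ends of the exceptional edge have
  eccentricity no larger than 3.\<close>

lemma ABC3_eqI:
  assumes nu: "\<And>u. u \<in> pverts G \<Longrightarrow> \<exists>v\<in>pverts G. v \<noteq> u \<and> \<not> adj u v"
    and card: "card (parcs G) = 2 * card (pverts G)"
    and pq: "adj p q" "\<not> central p" "\<not> central q" "adj p p'" "central p'" "adj q q'" "central q'"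
    and central: "\<And>u v. adj u v \<Longrightarrow> {u, v} \<noteq> {p, q} \<Longrightarrow> central u \<or> central v"
  shows "ABC3 G = (real (card (pverts G)) - 1) * sqrt (1 / 2) + abc_f 3 3"
proof (rule ABC3_eq)
  show "\<not> universal u" if "u \<in> pverts G" for u
    using nu[OF that] by (auto simp: universal_def)
qed (use card pq central ecc_eq_3 in auto)

text \<open>The exceptional edge is \<open>v2 v3\<close>, opposite to the vertex carrying the
  leaves; a leaf is three steps from both of its ends.\<close>

lemma ABC3_pentagon:
  assumes dist: "distinct [v0, v1, v2, v3, v4]" and P: "{v0, v1, v2, v3, v4} \<inter> P = {}" "finite P" "P \<noteq> {}"
    and V: "pverts G = {v0, v1, v2, v3, v4} \<union> P"
    and arcs: "parcs G = symcl ({(v0, v1), (v1, v2), (v2, v3), (v3, v4), (v4, v0)} \<union> {v0} \<times> P)"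
  shows "ABC3 G = (real (card (pverts G)) - 1) * sqrt (1 / 2) + abc_f 3 3"
proof -
  have adj_iff: "adj u v \<longleftrightarrow> u = v0 \<and> v = v1 \<or> u = v1 \<and> v = v2 \<or> u = v2 \<and> v = v3 \<or> u = v3 \<and> v = v4 \<or>
      u = v4 \<and> v = v0 \<or> u = v0 \<and> v \<in> P \<or> v = v0 \<and> u = v1 \<or> v = v1 \<and> u = v2 \<or> v = v2 \<and> u = v3 \<or>
      v = v3 \<and> u = v4 \<or> v = v4 \<and> u = v0 \<or> v = v0 \<and> u \<in> P" for u v
    unfolding arcs symcl_iff by (simp; metis)
  have ne: "v0 \<noteq> v1" "v0 \<noteq> v2" "v0 \<noteq> v3" "v0 \<noteq> v4" "v1 \<noteq> v2" "v1 \<noteq> v3" "v1 \<noteq> v4" "v2 \<noteq> v3" "v2 \<noteq> v4"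
    "v3 \<noteq> v4" "v0 \<notin> P" "v1 \<notin> P" "v2 \<notin> P" "v3 \<notin> P" "v4 \<notin> P"
    using dist P(1) by auto
  obtain w where w: "w \<in> P" using P(3) by auto
  have ne_w: "w \<noteq> v0" "w \<noteq> v1" "w \<noteq> v2" "w \<noteq> v3" "w \<noteq> v4" using w ne by auto
  have central: "central v0" "central v1" "central v4"
  proof -
    have "adj v0 v1" "adj v1 v0" "adj v1 v2" "adj v2 v3" "adj v3 v2" "adj v4 v3" "adj v4 v0" "adj v0 v4"
      "\<forall>u\<in>P. adj v0 u" by (simp_all add: adj_iff)
    then show "central v0" "central v1" "central v4"
      unfolding central_def V ball_Un ball_simps by (intro conjI TrueI; metis)+
  qed
  show ?thesis
  proof (rule ABC3_eqI[of v2 v3 v1 v4])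
    show "\<exists>v\<in>pverts G. v \<noteq> u \<and> \<not> adj u v" if "u \<in> pverts G" for u
    proof -
      have "\<not> adj v0 v2" "\<not> adj v1 v3" "\<not> adj v2 v4" "\<not> adj v3 v0" "\<not> adj v4 v1"
        "u \<in> P \<Longrightarrow> \<not> adj u v1" "u \<in> P \<Longrightarrow> u \<noteq> v1"
        using ne by (auto simp: adj_iff)
      then show ?thesis using that ne unfolding V by auto
    qed
    show "card (parcs G) = 2 * card (pverts G)"
    proof -
      let ?R = "{(v0, v1), (v1, v2), (v2, v3), (v3, v4), (v4, v0)} \<union> {v0} \<times> P"
      have "card ?R = card {(v0, v1), (v1, v2), (v2, v3), (v3, v4), (v4, v0)} + card ({v0} \<times> P)"
        using ne P(2) by (intro card_Un_disjoint) auto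
      also have "\<dots> = 5 + card P" using ne by (simp add: card_cartesian_product_singleton)
      also have "\<dots> = card (pverts G)"
      proof -
        have "card (pverts G) = card {v0, v1, v2, v3, v4} + card P"
          unfolding V using P by (intro card_Un_disjoint) auto
        then show ?thesis using ne by simp
      qed
      finally have "card ?R = card (pverts G)" .
      moreover have "card (symcl ?R) = 2 * card ?R"
        by (rule card_symcl) (use ne P(2) in auto)
      ultimately show ?thesis unfolding arcs by simp
    qed
    show "adj v2 v3" "adj v2 v1" "adj v3 v4" by (simp_all add: adj_iff)
    show "\<not> central v2"
      by (rule not_centralI[of w]) (use w ne ne_w in \<open>auto simp: adj_iff V\<close>)
    show "\<not> central v3"
      by (rule not_centralI[of w]) (use w ne ne_w in \<open>auto simp: adj_iff V\<close>)
    show "central u \<or> central v" if "adj u v" "{u, v} \<noteq> {v2, v3}" for u v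
    proof -
      have "u \<in> {v0, v1, v4} \<or> v \<in> {v0, v1, v4}"
        using that unfolding adj_iff by auto
      then show ?thesis using central by auto
    qed
  qed (fact central)+
qed

text \<open>The exceptional edge is \<open>v2 v3\<close>, opposite to \<open>v0 v1\<close>. Its end
  \<open>v2\<close> is three steps from the leaves in \<open>P\<close>, its end \<open>v3\<close>
  from those in \<open>Q\<close>, which is why both sets are nonempty.\<close>

lemma ABC3_quadrangle:
  assumes dist: "distinct [v0, v1, v2, v3]" and P: "{v0, v1, v2, v3} \<inter> (P \<union> Q) = {}" "P \<inter> Q = {}"
      "finite P" "finite Q" "P \<noteq> {}" "Q \<noteq> {}"
    and V: "pverts G = {v0, v1, v2, v3} \<union> P \<union> Q"
    and arcs: "parcs G = symcl ({(v0, v1), (v1, v2), (v2, v3), (v3, v0)} \<union> {v0} \<times> P \<union> {v1} \<times> Q)"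
  shows "ABC3 G = (real (card (pverts G)) - 1) * sqrt (1 / 2) + abc_f 3 3"
proof -
  have adj_iff: "adj u v \<longleftrightarrow> u = v0 \<and> v = v1 \<or> u = v1 \<and> v = v2 \<or> u = v2 \<and> v = v3 \<or> u = v3 \<and> v = v0 \<or>
      u = v0 \<and> v \<in> P \<or> u = v1 \<and> v \<in> Q \<or> v = v0 \<and> u = v1 \<or> v = v1 \<and> u = v2 \<or> v = v2 \<and> u = v3 \<or>
      v = v3 \<and> u = v0 \<or> v = v0 \<and> u \<in> P \<or> v = v1 \<and> u \<in> Q" for u v
    unfolding arcs symcl_iff by (simp; metis)
  have ne: "v0 \<noteq> v1" "v0 \<noteq> v2" "v0 \<noteq> v3" "v1 \<noteq> v2" "v1 \<noteq> v3" "v2 \<noteq> v3"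
    "v0 \<notin> P" "v1 \<notin> P" "v2 \<notin> P" "v3 \<notin> P" "v0 \<notin> Q" "v1 \<notin> Q" "v2 \<notin> Q" "v3 \<notin> Q"
    using dist P(1) by auto
  have PQ: "\<And>u. u \<in> P \<Longrightarrow> u \<notin> Q" using P(2) by auto
  obtain w w' where w: "w \<in> P" "w' \<in> Q" using P(5,6) by auto
  have ne_w: "w \<noteq> v0" "w \<noteq> v1" "w \<noteq> v2" "w \<noteq> v3" "w' \<noteq> v0" "w' \<noteq> v1" "w' \<noteq> v2" "w' \<noteq> v3"
    "w \<notin> Q" "w' \<notin> P"
    using w ne PQ by auto
  have central: "central v0" "central v1"
  proof -
    have "adj v0 v1" "adj v1 v0" "adj v1 v2" "adj v0 v3"
      "\<forall>u\<in>P. adj v0 u" "\<forall>u\<in>Q. adj v1 u" by (simp_all add: adj_iff)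
    then show "central v0" "central v1"
      unfolding central_def V ball_Un ball_simps by (intro conjI TrueI; metis)+
  qed
  show ?thesis
  proof (rule ABC3_eqI[of v2 v3 v1 v0])
    show "\<exists>v\<in>pverts G. v \<noteq> u \<and> \<not> adj u v" if "u \<in> pverts G" for u
    proof -
      have "\<not> adj v0 v2" "\<not> adj v1 v3" "\<not> adj v2 v0" "\<not> adj v3 v1"
        "u \<in> P \<Longrightarrow> \<not> adj u v1" "u \<in> P \<Longrightarrow> u \<noteq> v1" "u \<in> Q \<Longrightarrow> \<not> adj u v0" "u \<in> Q \<Longrightarrow> u \<noteq> v0"
        using ne PQ by (auto simp: adj_iff)
      then show ?thesis using that ne unfolding V by auto
    qed
    show "card (parcs G) = 2 * card (pverts G)"
    proof -
      let ?S = "{(v0, v1), (v1, v2), (v2, v3), (v3, v0)}"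
      let ?R = "?S \<union> {v0} \<times> P \<union> {v1} \<times> Q"
      have "card ?R = card (?S \<union> {v0} \<times> P) + card ({v1} \<times> Q)"
        using ne P by (intro card_Un_disjoint) auto
      also have "card (?S \<union> {v0} \<times> P) = card ?S + card ({v0} \<times> P)"
        using ne P by (intro card_Un_disjoint) auto
      also have "card ?S = 4" using ne by simp
      finally have "card ?R = 4 + card P + card Q" by (simp add: card_cartesian_product_singleton)
      also have "\<dots> = card (pverts G)"
      proof -
        have "card (pverts G) = card ({v0, v1, v2, v3} \<union> P) + card Q"
          unfolding V using P by (intro card_Un_disjoint) auto
        also have "card ({v0, v1, v2, v3} \<union> P) = card {v0, v1, v2, v3} + card P"
          using P by (intro card_Un_disjoint) auto
        finally show ?thesis using ne by simp
      qed
      finally have "card ?R = card (pverts G)" .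
      moreover have "card (symcl ?R) = 2 * card ?R"
        by (rule card_symcl) (use ne P(3,4) in auto)
      ultimately show ?thesis unfolding arcs by simp
    qed
    show "adj v2 v3" "adj v2 v1" "adj v3 v0" by (simp_all add: adj_iff)
    show "\<not> central v2"
      by (rule not_centralI[of w]) (use w ne ne_w in \<open>auto simp: adj_iff V\<close>)
    show "\<not> central v3"
      by (rule not_centralI[of w']) (use w ne ne_w in \<open>auto simp: adj_iff V\<close>)
    show "central u \<or> central v" if "adj u v" "{u, v} \<noteq> {v2, v3}" for u v
    proof -
      have "u \<in> {v0, v1} \<or> v \<in> {v0, v1}"
        using that unfolding adj_iff by auto
      then show ?thesis using central by auto
    qed
  qed (fact central)+
qed

text \<open>The exceptional edge is \<open>v1 v2\<close>, each end being three steps from every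
  vertex of \<open>T\<close>. Both ends have \<open>v0\<close> as central neighbour, so
  \<open>v0\<close> is supplied twice.\<close>

lemma ABC3_triangle_ext:
  assumes dist: "distinct [v0, v1, v2]" and d: "d \<in> M"
    and MT: "{v0, v1, v2} \<inter> (M \<union> T) = {}" "M \<inter> T = {}" "finite M" "finite T" "T \<noteq> {}"
    and V: "pverts G = {v0, v1, v2} \<union> M \<union> T"
    and arcs: "parcs G = symcl ({(v0, v1), (v1, v2), (v2, v0)} \<union> {v0} \<times> M \<union> {d} \<times> T)"
  shows "ABC3 G = (real (card (pverts G)) - 1) * sqrt (1 / 2) + abc_f 3 3"
proof -
  have adj_iff: "adj u v \<longleftrightarrow> u = v0 \<and> v = v1 \<or> u = v1 \<and> v = v2 \<or> u = v2 \<and> v = v0 \<or>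
      u = v0 \<and> v \<in> M \<or> u = d \<and> v \<in> T \<or> v = v0 \<and> u = v1 \<or> v = v1 \<and> u = v2 \<or> v = v2 \<and> u = v0 \<or>
      v = v0 \<and> u \<in> M \<or> v = d \<and> u \<in> T" for u v
    unfolding arcs symcl_iff by (simp; metis)
  have ne: "v0 \<noteq> v1" "v0 \<noteq> v2" "v1 \<noteq> v2"
    "v0 \<notin> M" "v1 \<notin> M" "v2 \<notin> M" "v0 \<notin> T" "v1 \<notin> T" "v2 \<notin> T" "d \<notin> T" "d \<noteq> v0" "d \<noteq> v1" "d \<noteq> v2"
    using dist MT(1,2) d by auto
  have MT': "\<And>u. u \<in> M \<Longrightarrow> u \<notin> T" using MT(2) by auto
  obtain w where w: "w \<in> T" using MT(5) by auto
  have ne_w: "w \<noteq> v0" "w \<noteq> v1" "w \<noteq> v2" "w \<noteq> d" "w \<notin> M"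
    using w ne MT' by auto
  have central: "central v0" "central d"
  proof -
    have "adj v0 v1" "adj v0 v2" "adj v0 d" "adj d v0" "\<forall>u\<in>M. adj v0 u" "\<forall>u\<in>T. adj d u"
      using d by (simp_all add: adj_iff)
    then show "central v0" "central d"
      unfolding central_def V ball_Un ball_simps by (intro conjI TrueI; metis)+
  qed
  show ?thesis
  proof (rule ABC3_eqI[of v1 v2 v0 v0])
    show "\<exists>v\<in>pverts G. v \<noteq> u \<and> \<not> adj u v" if "u \<in> pverts G" for u
    proof -
      have "\<not> adj v0 w" "\<not> adj v1 d" "\<not> adj v2 d"
        "u \<in> M \<Longrightarrow> \<not> adj u v1" "u \<in> M \<Longrightarrow> u \<noteq> v1" "u \<in> T \<Longrightarrow> \<not> adj u v0" "u \<in> T \<Longrightarrow> u \<noteq> v0"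
        using ne ne_w MT' by (auto simp: adj_iff)
      then show ?thesis using that ne d w ne_w unfolding V by auto
    qed
    show "card (parcs G) = 2 * card (pverts G)"
    proof -
      let ?S = "{(v0, v1), (v1, v2), (v2, v0)}"
      let ?R = "?S \<union> {v0} \<times> M \<union> {d} \<times> T"
      have "card ?R = card (?S \<union> {v0} \<times> M) + card ({d} \<times> T)"
        using ne MT by (intro card_Un_disjoint) auto
      also have "card (?S \<union> {v0} \<times> M) = card ?S + card ({v0} \<times> M)"
        using ne MT by (intro card_Un_disjoint) auto
      also have "card ?S = 3" using ne by simp
      finally have "card ?R = 3 + card M + card T" by (simp add: card_cartesian_product_singleton)
      also have "\<dots> = card (pverts G)"
      proof -
        have "card (pverts G) = card ({v0, v1, v2} \<union> M) + card T"
          unfolding V using MT by (intro card_Un_disjoint) auto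
        also have "card ({v0, v1, v2} \<union> M) = card {v0, v1, v2} + card M"
          using MT by (intro card_Un_disjoint) auto
        finally show ?thesis using ne by simp
      qed
      finally have "card ?R = card (pverts G)" .
      moreover have "card (symcl ?R) = 2 * card ?R"
        by (rule card_symcl) (use ne d MT' MT(3,4) in auto)
      ultimately show ?thesis unfolding arcs by simp
    qed
    show "adj v1 v2" "adj v1 v0" "adj v2 v0" by (simp_all add: adj_iff)
    show "\<not> central v1"
      by (rule not_centralI[of w]) (use w ne ne_w in \<open>auto simp: adj_iff V\<close>)
    show "\<not> central v2"
      by (rule not_centralI[of w]) (use w ne ne_w in \<open>auto simp: adj_iff V\<close>)
    show "central u \<or> central v" if "adj u v" "{u, v} \<noteq> {v1, v2}" for u v
    proof -
      have "u \<in> {v0, d} \<or> v \<in> {v0, d}"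
        using that unfolding adj_iff by auto
      then show ?thesis using central by auto
    qed
  qed (fact central)+
qed

end

section \<open>Upper bound and equality case\<close>

theorem theorem3p3:
  fixes G :: "'a pair_pre_digraph" and n :: nat
  assumes "unicyclic G"
    and "card (pverts G) = n"
    and "n \<ge> 6"
    and "\<not> graph_iso G (cycle_pendants [n - 4, 0, 0, 0])"
    and "\<not> (\<exists>n1 n2 n3. n1 + n2 + n3 = n - 3 \<and> graph_iso G (cycle_pendants [n1, n2, n3]))"
  shows "ABC3 G \<le> (real n - 1) * sqrt (1 / 2) + abc_f 3 3 \<and>
    (ABC3 G = (real n - 1) * sqrt (1 / 2) + abc_f 3 3 \<longleftrightarrow>
      graph_iso G (cycle_pendants [n - 5, 0, 0, 0, 0]) \<or>
      (\<exists>n1 n2. n1 \<ge> 1 \<and> n2 \<ge> 1 \<and> n1 + n2 = n - 4 \<and> graph_iso G (cycle_pendants [n1, n2, 0, 0])) \<or>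
      (\<exists>t m. t \<ge> 1 \<and> m \<ge> 1 \<and> m + t = n - 3 \<and> graph_iso G (triangle_pendants_ext t m)))"
    (is "?le \<and> (?eq \<longleftrightarrow> ?I5 \<or> ?I4 \<or> ?I3)")
proof -
  interpret pair_graph G using assms(1) by (simp add: unicyclic_def)
  interpret at_most_unicyclic_graph G
    using assms(1) by unfold_locales (auto simp: unicyclic_def)
  have wf: "pair_wf_digraph G" by (rule pair_wf_digraph)
  \<comment> \<open>Here the hypotheses strike the excluded graphs from the alternatives of
    \<open>small_or_listed\<close>.\<close>
  have small: "ABC3 G < (real n - 1) * sqrt (1 / 2) + abc_f 3 3 \<or> ?I5 \<or> ?I4 \<or> ?I3"
    using small_or_listed assms(2-5) unfolding small_or_listed_def Let_def by simp
  have I5: ?eq if ?I5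
    using wf that
  proof (rule graph_iso_pentagon_pendantsE)
    fix v0 v1 v2 v3 v4 P
    assume *: "card P = n - 5" "finite P" "distinct [v0, v1, v2, v3, v4]"
      "{v0, v1, v2, v3, v4} \<inter> P = {}" "pverts G = {v0, v1, v2, v3, v4} \<union> P"
      "parcs G = symcl ({(v0, v1), (v1, v2), (v2, v3), (v3, v4), (v4, v0)} \<union> {v0} \<times> P)"
    \<comment> \<open>\<open>n \<ge> 6\<close> makes \<open>n - 5\<close> positive, so there is a
      leaf to make the opposite edge far.\<close>
    have "P \<noteq> {}" using *(1) assms(3) by auto
    then show ?eq using ABC3_pentagon[OF *(3,4,2) _ *(5,6)] assms(2) by simp
  qed
  have I4: ?eq if h: ?I4
  proof -
    obtain n1 n2 where n12: "n1 \<ge> 1" "n2 \<ge> 1" "graph_iso G (cycle_pendants [n1, n2, 0, 0])"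
      using h by blast
    show ?eq
      using wf n12(3)
    proof (rule graph_iso_quadrangle_pendantsE)
      fix v0 v1 v2 v3 P Q
      assume *: "card P = n1" "card Q = n2" "finite P" "finite Q" "distinct [v0, v1, v2, v3]"
        "{v0, v1, v2, v3} \<inter> (P \<union> Q) = {}" "P \<inter> Q = {}" "pverts G = {v0, v1, v2, v3} \<union> P \<union> Q"
        "parcs G = symcl ({(v0, v1), (v1, v2), (v2, v3), (v3, v0)} \<union> {v0} \<times> P \<union> {v1} \<times> Q)"
      have "P \<noteq> {}" "Q \<noteq> {}" using *(1,2) n12 by auto
      then show ?eq using ABC3_quadrangle[OF *(5-7,3,4) _ _ *(8,9)] assms(2) by simp
    qed
  qed
  have I3: ?eq if h: ?I3
  proof -
    obtain t m where tm: "t \<ge> 1" "m \<ge> 1" "graph_iso G (triangle_pendants_ext t m)"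
      using h by blast
    obtain a b c d M T where *: "card M = m" "card T = t" "finite M" "finite T" "distinct [a, b, c]" "d \<in> M"
      "M \<inter> T = {}" "{a, b, c} \<inter> (M \<union> T) = {}" "pverts G = {a, b, c} \<union> M \<union> T"
      "parcs G = symcl ({(a, b), (b, c), (c, a)} \<union> {a} \<times> M \<union> {d} \<times> T)"
      using tm(3) unfolding graph_iso_triangle_pendants_ext_iff[OF wf tm(2)] by (elim exE conjE that)
    have "T \<noteq> {}" using *(2) tm by auto
    then show ?eq using ABC3_triangle_ext[OF *(5,6,8,7,3,4) _ *(9,10)] assms(2) by simp
  qed
  show ?thesis
  proof (cases "?I5 \<or> ?I4 \<or> ?I3")
    case True
    have eq: ?eq using True I5 I4 I3 by (elim disjE)
    show ?thesis
    proof (intro conjI iffI)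
      show ?le using eq by simp
    qed (rule True, rule eq)
  next
    case False
    have less: "ABC3 G < (real n - 1) * sqrt (1 / 2) + abc_f 3 3"
      by (rule disjE[OF small], assumption, rule notE[OF False])
    show ?thesis
    proof (intro conjI iffI)
      show ?le using less by simp
      show "?I5 \<or> ?I4 \<or> ?I3" if ?eq using that less by simp
      show ?eq if "?I5 \<or> ?I4 \<or> ?I3" using False that by (rule notE)
    qed
  qed
qed

end
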